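(* Let $A$ be an RSLR type and $t,s$ closed RSLR terms of type $A$. Then $\delta^{\mathtt T}(t,s)=\delta^{\mathtt C}(t,s)$.
   Context: \textbf{The calculus RSLR.} Aspects are $\square$ and $\blacksquare$, ordered by $\square<:\square$, $\square<:\blacksquare$, $\blacksquare<:\blacksquare$. Types: $A::=\mathsf{Str}\mid\mathsf aA\to A$. Subtyping: least reflexive transitive relation with $\mathsf aA\to C<:\mathsf bB\to D$ whenever $B<:A$, $C<:D$, $\mathsf a<:\mathsf b$. Terms: $t::=x\mid\underline m\mid\lambda x:\mathsf aA.t\mid\mathsf0(t)\mid\mathsf1(t)\mid\mathsf{tail}(t)\mid t\,t\mid\mathsf{case}_A(t,t_0,t_1,t_\epsilon)\mid\mathsf{rec}_A(t,t_0,t_1,t_\epsilon)\mid\mathsf{rand}$ with $m\in\{0,1\}^*$ ($\underline\epsilon$ empty string); values are string constants and abstractions. Typing contexts are finite sets of declarations $x:\mathsf aA$; $\Gamma;\Delta$ denotes disjoint union where $\Gamma$ declares only $\mathsf{Str}$ variables; $\Gamma<:\mathsf a$ means all declared aspects $\mathsf b$ satisfy $\mathsf b<:\mathsf a$. Typing rules: variables, string constants of type $\mathsf{Str}$, $\mathsf0,\mathsf1,\mathsf{tail}$ from $\mathsf{Str}$ to $\mathsf{Str}$, $\vdash\mathsf{rand}:\mathsf{Str}$, abstraction, subsumption; application: $\Gamma;\Delta_1\vdash t:\mathsf aA\to B$, $\Gamma;\Delta_2\vdash s:A$, $\Gamma,\Delta_2<:\mathsf a$ give $\Gamma;\Delta_1,\Delta_2\vdash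 ts:B$; case: $\Gamma;\Delta_1\vdash t:\mathsf{Str}$, $\Gamma;\Delta_2\vdash t_0:A$, $\Gamma;\Delta_3\vdash t_1:A$, $\Gamma;\Delta_4\vdash t_\epsilon:A$ give $\Gamma;\Delta_1,\dots,\Delta_4\vdash\mathsf{case}_A(t,t_0,t_1,t_\epsilon):A$; recursion: $\Gamma_1;\Delta_1\vdash t:\mathsf{Str}$, $\Gamma_1,\Gamma_2\vdash t_0:\square\mathsf{Str}\to\blacksquare A\to A$, $\Gamma_1,\Gamma_3\vdash t_1:\square\mathsf{Str}\to\blacksquare A\to A$, $\Gamma_1,\Gamma_2,\Gamma_3;\Delta_2\vdash t_\epsilon:A$, $\Gamma_1,\Delta_1<:\square$, $A$ $\square$-free give $\Gamma_1,\Gamma_2,\Gamma_3;\Delta_1,\Delta_2\vdash\mathsf{rec}_A(t,t_0,t_1,t_\epsilon):A$. Every closed typable $t$ has a value distribution $[\![t]\!]$ given by probabilistic call-by-value big-step semantics: values evaluate to themselves; $\mathsf{rand}$ yields $\underline0,\underline1$ with probability $1/2$ each; $\mathsf0,\mathsf1$ prepend a bit, $\mathsf{tail}$ drops the first bit ($\mathrm{tail}(\epsilon)=\epsilon$); $[\![ts]\!]=\sum[\![t]\!](\lambda x.r)[\![s]\!](v)[\![r\{v/x\}]\!]$; $\mathsf{case}$ continues with $t_0$, $t_1$ or $t_\epsilon$ according to whether the evaluated string begins with $0$, with $1$, or is empty; $\mathsf{rec}_A(\underline\epsilon,\dots)$ continues as $t_\epsilon$, $\mathsf{rec}_A(\underline{bn},t_0,t_1,t_\epsilon)$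 as $(t_b\,\underline{bn})(\mathsf{rec}_A(\underline n,t_0,t_1,t_\epsilon))$. \textbf{Contexts and context distance.} Contexts are generated by $C::=t\mid[\cdot]\mid\lambda x.C\mid C\,t\mid t\,C\mid\mathsf0(C)\mid\mathsf1(C)\mid\mathsf{tail}(C)\mid\mathsf{case}_A(C,t,t,t)\mid\mathsf{case}_A(t,C,C,C)\mid\mathsf{rec}_A(C,t,t,t)$, hole occurring at most once; $C[t]$ fills the hole with the closed term $t$; $\vdash C[\vdash A]:B$ means that for every closed $t$ with $\vdash t:A$, $\vdash C[t]:B$. The context distance is $\delta^{\mathtt C}(t,s)=\sup_{C:\ \vdash C[\vdash A]:\mathsf{Str}}|[\![C[t]]\!](\underline\epsilon)-[\![C[s]]\!](\underline\epsilon)|$. \textbf{Trace distance.} Actions are $\mathsf{pass}(v)$ ($v$ closed value) and $\mathsf{view}(M)$ ($M$ a finite set of strings). Traces compatible with $\mathsf{Str}$: $\mathsf{view}(M)$; with $\mathsf bB\to C$: $\mathsf{pass}(v)\cdot S$ with $\vdash v:B$, $S$ compatible with $C$. For $t$ closed of type $\mathsf a_1A_1\to\cdots\to\mathsf a_kA_k\to\mathsf{Str}$ and $T=\mathsf{pass}(v_1)\cdots\mathsf{pass}(v_k)\mathsf{view}(M)$: $\mathcal D_0=[\![t]\!]$, $\mathcal D_i=\sum_{\lambda x.r}\mathcal D_{i-1}(\lambda x.r)[\![r\{v_i/x\}]\!]$, $\Pr(t,T)=\sum_{m\in M}\mathcal D_k(\underline m)$. The trace distance is $\delta^{\mathtt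 T}(t,s)=\sup_T|\Pr(t,T)-\Pr(s,T)|$ over traces compatible with $A$. *)

theory Defs
  imports "HOL-Probability.Probability_Mass_Function"
begin

section \<open>Types and subtyping\<close>

text \<open>\<open>White\<close> is the aspect written as an empty square, \<open>Black\<close> the one written as a filled square.\<close>

datatype aspect = White | Black

inductive asp_le :: "aspect \<Rightarrow> aspect \<Rightarrow> bool" where
  "asp_le White White"
| "asp_le White Black"
| "asp_le Black Black"

datatype ty = Str | Arr aspect ty ty

inductive subty :: "ty \<Rightarrow> ty \<Rightarrow> bool" where
  subty_refl: "subty A A"
| subty_trans: "subty A B \<Longrightarrow> subty B C \<Longrightarrow> subty A C"
| subty_arr: "subty B A \<Longrightarrow> subty C D \<Longrightarrow> asp_le a b \<Longrightarrow> subty (Arr a A C) (Arr b B D)"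

fun white_free :: "ty \<Rightarrow> bool" where
  "white_free Str \<longleftrightarrow> True"
| "white_free (Arr a A B) \<longleftrightarrow> a = Black \<and> white_free A \<and> white_free B"

section \<open>Terms\<close>

text \<open>
  Bits are booleans, with \<open>False\<close> for 0 and \<open>True\<close> for 1. Variables are de Bruijn indices, so that
  terms are identified up to renaming of bound variables. In the last two constructors the
  arguments are, in order, the scrutinee, the branch for 0, the branch for 1 and the branch for the
  empty string.
\<close>

type_synonym bitstring = "bool list"

datatype tm =
    Var nat
  | Const bitstring
  | Lam aspect ty tm
  | Push0 tm
  | Push1 tm
  | Tail tm
  | App tm tm
  | Case ty tm tm tm tm
  | Rec ty tm tm tm tm
  | Rand

inductive is_value :: "tm \<Rightarrow> bool" where
  "is_value (Const m)"
| "is_value (Lam a A t)"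

text \<open>
  \<open>subst k v t\<close> replaces index \<open>k\<close> by \<open>v\<close> and lowers the indices above \<open>k\<close>. It is only ever used
  with closed \<open>v\<close>, which therefore needs no shifting under binders.
\<close>

fun subst :: "nat \<Rightarrow> tm \<Rightarrow> tm \<Rightarrow> tm" where
  "subst k v (Var i) = (if i < k then Var i else if i = k then v else Var (i - 1))"
| "subst k v (Const m) = Const m"
| "subst k v (Lam a A t) = Lam a A (subst (Suc k) v t)"
| "subst k v (Push0 t) = Push0 (subst k v t)"
| "subst k v (Push1 t) = Push1 (subst k v t)"
| "subst k v (Tail t) = Tail (subst k v t)"
| "subst k v (App t s) = App (subst k v t) (subst k v s)"
| "subst k v (Case A t t0 t1 te) =
     Case A (subst k v t) (subst k v t0) (subst k v t1) (subst k v te)"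
| "subst k v (Rec A t t0 t1 te) =
     Rec A (subst k v t) (subst k v t0) (subst k v t1) (subst k v te)"
| "subst k v Rand = Rand"

section \<open>Typing\<close>

text \<open>
  Finiteness of typing contexts is not imposed on the type: every context in a derivation that
  ends in the empty context is finite, and only such derivations are used below.
\<close>

type_synonym env = "nat \<rightharpoonup> aspect \<times> ty"

definition ext :: "env \<Rightarrow> aspect \<Rightarrow> ty \<Rightarrow> env" where
  "ext E a A = case_nat (Some (a, A)) E"

definition str_only :: "env \<Rightarrow> bool" where
  "str_only E \<longleftrightarrow> (\<forall>d \<in> ran E. snd d = Str)"

definition env_below :: "env \<Rightarrow> aspect \<Rightarrow> bool" where
  "env_below E a \<longleftrightarrow> (\<forall>d \<in> ran E. asp_le (fst d) a)"

definition disjoint_envs :: "env list \<Rightarrow> bool" where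
  "disjoint_envs Es \<longleftrightarrow> sorted_wrt (\<lambda>E F. dom E \<inter> dom F = {}) Es"

text \<open>
  A judgement has a single context, which the multi-premise rules decompose. In those rules the
  letters \<open>G\<close> stand for the shared parts, declaring only string variables, and the letters \<open>D\<close> for
  the unshared parts.
\<close>

inductive typing :: "env \<Rightarrow> tm \<Rightarrow> ty \<Rightarrow> bool"  ("_ \<turnstile> _ : _" [50, 50, 50] 50) where
  T_Var: "E i = Some (a, A) \<Longrightarrow> E \<turnstile> Var i : A"
| T_Const: "E \<turnstile> Const m : Str"
| T_Push0: "E \<turnstile> t : Str \<Longrightarrow> E \<turnstile> Push0 t : Str"
| T_Push1: "E \<turnstile> t : Str \<Longrightarrow> E \<turnstile> Push1 t : Str"
| T_Tail: "E \<turnstile> t : Str \<Longrightarrow> E \<turnstile> Tail t : Str"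
| T_Rand: "E \<turnstile> Rand : Str"
| T_Lam: "ext E a A \<turnstile> t : B \<Longrightarrow> E \<turnstile> Lam a A t : Arr a A B"
| T_Sub: "E \<turnstile> t : A \<Longrightarrow> subty A B \<Longrightarrow> E \<turnstile> t : B"
| T_App:
    "\<lbrakk> str_only G; disjoint_envs [G, D1, D2];
       G ++ D1 \<turnstile> t : Arr a A B; G ++ D2 \<turnstile> s : A; env_below (G ++ D2) a \<rbrakk>
     \<Longrightarrow> G ++ D1 ++ D2 \<turnstile> App t s : B"
| T_Case:
    "\<lbrakk> str_only G; disjoint_envs [G, D1, D2, D3, D4];
       G ++ D1 \<turnstile> t : Str; G ++ D2 \<turnstile> t0 : A; G ++ D3 \<turnstile> t1 : A; G ++ D4 \<turnstile> te : A \<rbrakk>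
     \<Longrightarrow> G ++ D1 ++ D2 ++ D3 ++ D4 \<turnstile> Case A t t0 t1 te : A"
| T_Rec:
    "\<lbrakk> str_only G1; str_only G2; str_only G3; disjoint_envs [G1, G2, G3, D1, D2];
       G1 ++ D1 \<turnstile> t : Str;
       G1 ++ G2 \<turnstile> t0 : Arr White Str (Arr Black A A);
       G1 ++ G3 \<turnstile> t1 : Arr White Str (Arr Black A A);
       G1 ++ G2 ++ G3 ++ D2 \<turnstile> te : A;
       env_below (G1 ++ D1) White; white_free A \<rbrakk>
     \<Longrightarrow> G1 ++ G2 ++ G3 ++ D1 ++ D2 \<turnstile> Rec A t t0 t1 te : A"

abbreviation closed_typing :: "tm \<Rightarrow> ty \<Rightarrow> bool"  ("\<turnstile> _ : _" [50, 50] 50) where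
  "\<turnstile> t : A \<equiv> Map.empty \<turnstile> t : A"

section \<open>Probabilistic call-by-value semantics\<close>

fun case_branch :: "tm \<Rightarrow> tm \<Rightarrow> tm \<Rightarrow> bitstring \<Rightarrow> tm" where
  "case_branch t0 t1 te [] = te"
| "case_branch t0 t1 te (b # n) = (if b then t1 else t0)"

fun rec_unfold :: "ty \<Rightarrow> tm \<Rightarrow> tm \<Rightarrow> tm \<Rightarrow> bitstring \<Rightarrow> tm" where
  "rec_unfold A t0 t1 te [] = te"
| "rec_unfold A t0 t1 te (b # n) =
     App (App (if b then t1 else t0) (Const (b # n))) (Rec A (Const n) t0 t1 te)"

text \<open>
  In the rules that consume a string, the premise on the distribution \<open>map_pmf Const M\<close> says that the
  argument evaluates with probability one to string constants, distributed according to \<open>M\<close>.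
\<close>

inductive eval :: "tm \<Rightarrow> tm pmf \<Rightarrow> bool"  (infix "\<Down>" 50) where
  E_Value: "is_value v \<Longrightarrow> v \<Down> return_pmf v"
| E_Rand: "Rand \<Down> pmf_of_set {Const [False], Const [True]}"
| E_Push0: "t \<Down> map_pmf Const M \<Longrightarrow> Push0 t \<Down> map_pmf (\<lambda>m. Const (False # m)) M"
| E_Push1: "t \<Down> map_pmf Const M \<Longrightarrow> Push1 t \<Down> map_pmf (\<lambda>m. Const (True # m)) M"
| E_Tail: "t \<Down> map_pmf Const M \<Longrightarrow> Tail t \<Down> map_pmf (\<lambda>m. Const (tl m)) M"
| E_App:
    "\<lbrakk> t \<Down> D; s \<Down> E; \<And>w. w \<in> set_pmf D \<Longrightarrow> \<exists>a A r. w = Lam a A r;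
       \<And>a A r v. Lam a A r \<in> set_pmf D \<Longrightarrow> v \<in> set_pmf E \<Longrightarrow> subst 0 v r \<Down> F (Lam a A r) v \<rbrakk>
     \<Longrightarrow> App t s \<Down> bind_pmf D (\<lambda>w. bind_pmf E (\<lambda>v. F w v))"
| E_Case:
    "\<lbrakk> t \<Down> map_pmf Const M; \<And>m. m \<in> set_pmf M \<Longrightarrow> case_branch t0 t1 te m \<Down> F m \<rbrakk>
     \<Longrightarrow> Case A t t0 t1 te \<Down> bind_pmf M F"
| E_Rec:
    "\<lbrakk> t \<Down> map_pmf Const M; \<And>m. m \<in> set_pmf M \<Longrightarrow> rec_unfold A t0 t1 te m \<Down> F m \<rbrakk>
     \<Longrightarrow> Rec A t t0 t1 te \<Down> bind_pmf M F"

lemma map_pmf_Const_inject: "map_pmf Const M = map_pmf Const N \<Longrightarrow> M = N"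
  by (metis injI pmf.inj_map_strong tm.inject(2))

text \<open>Uniqueness, which justifies the description operator in the definition of \<open>sem\<close>.\<close>

lemma eval_unique:
  assumes "t \<Down> D" and "t \<Down> D'"
  shows "D' = D"
  using assms
proof (induction arbitrary: D' rule: eval.induct)
  case (E_Value v)
  from E_Value.prems E_Value.hyps show ?case
    by cases (auto elim: is_value.cases)
next
  case E_Rand
  then show ?case
    by cases (auto elim: is_value.cases)
next
  case (E_Push0 t M)
  from E_Push0.prems show ?case
  proof cases
    case (E_Push0 M2)
    then have "M2 = M"
      using E_Push0.IH map_pmf_Const_inject by blast
    then show ?thesis
      using E_Push0 by simp
  qed (auto elim: is_value.cases)
next
  case (E_Push1 t M)
  from E_Push1.prems show ?case
  proof cases
    case (E_Push1 M2)
    then have "M2 = M"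
      using E_Push1.IH map_pmf_Const_inject by blast
    then show ?thesis
      using E_Push1 by simp
  qed (auto elim: is_value.cases)
next
  case (E_Tail t M)
  from E_Tail.prems show ?case
  proof cases
    case (E_Tail M2)
    then have "M2 = M"
      using E_Tail.IH map_pmf_Const_inject by blast
    then show ?thesis
      using E_Tail by simp
  qed (auto elim: is_value.cases)
next
  case (E_App t D s E F)
  from E_App.prems show ?case
  proof cases
    case (E_App D2 E2 F2)
    have DE: "D2 = D" "E2 = E"
      using E_App.IH(1,2) E_App(2,3) by blast+
    have "F2 w v = F w v" if w: "w \<in> set_pmf D" and v: "v \<in> set_pmf E" for w v
    proof -
      obtain a A r where "w = Lam a A r"
        using E_App(4) w DE by blast
      then show ?thesis
        using E_App.IH(3) E_App(5) w v DE by blast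
    qed
    then show ?thesis
      unfolding E_App(1) DE by (intro bind_pmf_cong refl) simp
  qed (auto elim: is_value.cases)
next
  case (E_Case t M t0 t1 te F A)
  from E_Case.prems show ?case
  proof cases
    case (E_Case M2 F2)
    then have "M2 = M"
      using E_Case.IH(1) map_pmf_Const_inject by blast
    then show ?thesis
      using E_Case E_Case.IH(2) by (auto intro!: bind_pmf_cong)
  qed (auto elim: is_value.cases)
next
  case (E_Rec t M A t0 t1 te F)
  from E_Rec.prems show ?case
  proof cases
    case (E_Rec M2 F2)
    then have "M2 = M"
      using E_Rec.IH(1) map_pmf_Const_inject by blast
    then show ?thesis
      using E_Rec E_Rec.IH(2) by (auto intro!: bind_pmf_cong)
  qed (auto elim: is_value.cases)
qed

definition sem :: "tm \<Rightarrow> tm pmf"  ("\<lbrakk>_\<rbrakk>") where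
  "\<lbrakk>t\<rbrakk> = (THE D. t \<Down> D)"

section \<open>Context distance\<close>

text \<open>
  In \<open>C_Case1\<close> and \<open>C_Rec\<close> the hole may be in the scrutinee, in \<open>C_Case2\<close> in a branch. Contexts may
  bind variables above the hole; only closed terms are put there, so \<open>fill\<close> does not shift.
\<close>

datatype ctx =
    C_Tm tm
  | Hole
  | C_Lam aspect ty ctx
  | C_AppL ctx tm
  | C_AppR tm ctx
  | C_Push0 ctx
  | C_Push1 ctx
  | C_Tail ctx
  | C_Case1 ty ctx tm tm tm
  | C_Case2 ty tm ctx ctx ctx
  | C_Rec ty ctx tm tm tm

fun holes :: "ctx \<Rightarrow> nat" where
  "holes (C_Tm t) = 0"
| "holes Hole = 1"
| "holes (C_Lam a A C) = holes C"
| "holes (C_AppL C t) = holes C"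
| "holes (C_AppR t C) = holes C"
| "holes (C_Push0 C) = holes C"
| "holes (C_Push1 C) = holes C"
| "holes (C_Tail C) = holes C"
| "holes (C_Case1 A C t0 t1 te) = holes C"
| "holes (C_Case2 A t C0 C1 Ce) = holes C0 + holes C1 + holes Ce"
| "holes (C_Rec A C t0 t1 te) = holes C"

fun fill :: "ctx \<Rightarrow> tm \<Rightarrow> tm" where
  "fill (C_Tm t) u = t"
| "fill Hole u = u"
| "fill (C_Lam a A C) u = Lam a A (fill C u)"
| "fill (C_AppL C t) u = App (fill C u) t"
| "fill (C_AppR t C) u = App t (fill C u)"
| "fill (C_Push0 C) u = Push0 (fill C u)"
| "fill (C_Push1 C) u = Push1 (fill C u)"
| "fill (C_Tail C) u = Tail (fill C u)"
| "fill (C_Case1 A C t0 t1 te) u = Case A (fill C u) t0 t1 te"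
| "fill (C_Case2 A t C0 C1 Ce) u = Case A t (fill C0 u) (fill C1 u) (fill Ce u)"
| "fill (C_Rec A C t0 t1 te) u = Rec A (fill C u) t0 t1 te"

definition ctx_typing :: "ctx \<Rightarrow> ty \<Rightarrow> ty \<Rightarrow> bool" where
  "ctx_typing C A B \<longleftrightarrow> (\<forall>t. \<turnstile> t : A \<longrightarrow> \<turnstile> fill C t : B)"

definition ctx_dist :: "ty \<Rightarrow> tm \<Rightarrow> tm \<Rightarrow> real" where
  "ctx_dist A t s =
     (SUP C \<in> {C. holes C \<le> 1 \<and> ctx_typing C A Str}.
        \<bar>pmf \<lbrakk>fill C t\<rbrakk> (Const []) - pmf \<lbrakk>fill C s\<rbrakk> (Const [])\<bar>)"

section \<open>Trace distance\<close>

datatype action = Pass tm | View "bitstring set"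

type_synonym trace = "action list"

inductive compatible :: "ty \<Rightarrow> trace \<Rightarrow> bool" where
  "finite M \<Longrightarrow> compatible Str [View M]"
| "is_value v \<Longrightarrow> \<turnstile> v : B \<Longrightarrow> compatible C S \<Longrightarrow> compatible (Arr b B C) (Pass v # S)"

text \<open>
  One step from a distribution to the next when \<open>v\<close> is passed. The last clause is only there because a
  \<open>pmf\<close> has total mass one: on a term of arrow type the distribution is concentrated on abstractions.
\<close>

fun pass_value :: "tm \<Rightarrow> tm \<Rightarrow> tm pmf" where
  "pass_value v (Lam a A r) = \<lbrakk>subst 0 v r\<rbrakk>"
| "pass_value v w = return_pmf w"

text \<open>Only traces consisting of \<open>Pass\<close> actions followed by one \<open>View\<close> matter here.\<close>

fun trace_prob :: "tm pmf \<Rightarrow> trace \<Rightarrow> real" where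
  "trace_prob D (Pass v # T) = trace_prob (bind_pmf D (pass_value v)) T"
| "trace_prob D (View M # T) = (\<Sum>m\<in>M. pmf D (Const m))"
| "trace_prob D [] = 0"

definition Pr :: "tm \<Rightarrow> trace \<Rightarrow> real" where
  "Pr t T = trace_prob \<lbrakk>t\<rbrakk> T"

definition trace_dist :: "ty \<Rightarrow> tm \<Rightarrow> tm \<Rightarrow> real" where
  "trace_dist A t s = (SUP T \<in> {T. compatible A T}. \<bar>Pr t T - Pr s T\<bar>)"

end

(*
A context can learn about the term in its hole only by passing values to it and finally inspecting a
string. Values of arrow type are used affinely, since the shared parts of typing contexts hold
strings only; so when such a value is used in a context, it is applied once, to an argument that does
not mention it, which is one step of a trace. Strings may be copied, but then the hole's
distribution over strings is transformed by a fixed kernel, which does not increase total variation.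
Formally, a logical relation asks of function values that they terminate and do not increase the trace
distance between distributions of arguments; every typable term, seen as a function of any single free
variable, satisfies it, and so does every one-hole context. A context is typed by filling its hole
with a term whose minimal type is the type of the hole. Conversely, a trace is a context applying the
hole to the passed values and testing the resulting string by nested case distinctions.
*)
theory Submission
  imports Defs
begin

text \<open>The bound \<open>e\<close> must survive every term constructor without growing, and
  errors could add up if two premises of a rule varied independently. Hence every statement varies a
  single index, drawn from one of two distributions, and holds everything else fixed. Independent
  draws commute, so the fixed part is sampled first and the claim is proved for each of its
  outcomes.

  Distances have to be taken between mixtures, not between individual values: drawing a random bit
  and then returning a constant function, or returning one function that draws the bit when called,
  gives trace distance 0, although the values involved are pairwise far apart.

  Abstraction uses the induction hypothesis twice: with the bound variable varying, to see that each
  closure is a nonexpanding function, and with an outer variable varying, to compare the closures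
  themselves. In a recursion the base case sits once, at the bottom of a tower of fixed functions,
  so iteration does not multiply the error.\<close>

section \<open>Total variation of string distributions\<close>

definition view :: "bitstring set \<Rightarrow> tm pmf \<Rightarrow> real" where
  "view M D = (\<Sum>m\<in>M. pmf D (Const m))"

lemma view_eq_prob: "finite M \<Longrightarrow> view M D = measure_pmf.prob D (Const ` M)"
  by (simp add: view_def measure_measure_pmf_finite sum.reindex inj_on_def)

lemma view_nonneg: "0 \<le> view M D"
  by (simp add: view_def sum_nonneg)

text \<open>For infinite \<open>M\<close> the sum defining \<open>view\<close> is 0 by
  convention.\<close>

lemma view_le_1: "view M D \<le> 1"
  by (cases "finite M") (simp add: view_eq_prob, simp add: view_def)

lemma integrable_view: "integrable (measure_pmf D) (\<lambda>x. view M (F x))"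
  by (rule measure_pmf.integrable_const_bound[where B = 1]) (auto simp: view_nonneg view_le_1)

lemma view_bind: "view M (bind_pmf D F) = measure_pmf.expectation D (\<lambda>x. view M (F x))"
proof -
  have "integrable (measure_pmf D) (\<lambda>x. pmf (F x) (Const m))" for m
    by (rule measure_pmf.integrable_const_bound[where B = 1]) (auto simp: pmf_le_1)
  then show ?thesis
    by (simp add: view_def pmf_bind)
qed

text \<open>Traces view only finite sets, whereas the event separating two distributions best may be
  infinite. A countable set is exhausted by finite ones, and probability is continuous along
  increasing unions.\<close>

lemma prob_diff_le_finite:
  fixes M N :: "'a::countable pmf"
  assumes "\<And>F. finite F \<Longrightarrow> measure_pmf.prob M F - measure_pmf.prob N F \<le> e"
  shows "measure_pmf.prob M S - measure_pmf.prob N S \<le> e"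
proof -
  define F where "F n = S \<inter> {x. to_nat x \<le> n}" for n
  have fin: "finite (F n)" for n
  proof -
    have "finite (to_nat -` {..n} :: 'a set)"
      by (rule finite_vimageI) auto
    moreover have "F n \<subseteq> to_nat -` {..n}"
      by (auto simp: F_def)
    ultimately show ?thesis by (rule finite_subset[rotated])
  qed
  have inc: "incseq F"
    by (auto simp: F_def incseq_def)
  have un: "(\<Union>n. F n) = S"
    by (auto simp: F_def)
  have lim: "(\<lambda>n. measure_pmf.prob P (F n)) \<longlonglongrightarrow> measure_pmf.prob P S" for P :: "'a pmf"
    using measure_pmf.finite_Lim_measure_incseq[of F P] inc un by auto
  have "(\<lambda>n. measure_pmf.prob M (F n) - measure_pmf.prob N (F n))
          \<longlonglongrightarrow> measure_pmf.prob M S - measure_pmf.prob N S"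
    by (intro tendsto_diff lim)
  then show ?thesis
    by (rule LIMSEQ_le_const2) (use assms fin in auto)
qed

text \<open>Among tests with values in [0,1] the best one is the indicator of the set
  \<open>S\<close> where \<open>M\<close> outweighs \<open>N\<close>; the comparison is pointwise in
  the densities.\<close>

lemma expectation_diff_le:
  fixes M N :: "'a::countable pmf"
  assumes fin: "\<And>F. finite F \<Longrightarrow> measure_pmf.prob M F - measure_pmf.prob N F \<le> e"
    and f: "\<And>x. 0 \<le> f x" "\<And>x. f x \<le> (1::real)"
  shows "measure_pmf.expectation M f - measure_pmf.expectation N f \<le> e"
proof -
  define S where "S = {x. pmf N x \<le> pmf M x}"
  have dens: "measure_pmf.expectation P g = (\<integral>x. pmf P x * g x \<partial>count_space UNIV)"
    for P :: "'a pmf" and g :: "'a \<Rightarrow> real"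
    by (subst measure_pmf_eq_density) (simp add: integral_density)
  have int: "integrable (count_space UNIV) (\<lambda>x. pmf P x * g x)"
    if "\<And>x. \<bar>g x\<bar> \<le> 1" for P :: "'a pmf" and g :: "'a \<Rightarrow> real"
    by (rule Bochner_Integration.integrable_bound[OF integrable_pmf[of UNIV P]])
      (use that in \<open>auto simp: abs_mult intro!: mult_left_le\<close>)
  have "measure_pmf.expectation M f - measure_pmf.expectation N f
      = (\<integral>x. pmf M x * f x - pmf N x * f x \<partial>count_space UNIV)"
    unfolding dens using f by (subst Bochner_Integration.integral_diff) (auto intro!: int)
  also have "\<dots> \<le> (\<integral>x. pmf M x * indicat_real S x - pmf N x * indicat_real S x \<partial>count_space UNIV)"
  proof (rule integral_mono)
    fix x
    show "pmf M x * f x - pmf N x * f x \<le> pmf M x * indicat_real S x - pmf N x * indicat_real S x"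
    proof (cases "x \<in> S")
      case True
      then have "(pmf M x - pmf N x) * f x \<le> (pmf M x - pmf N x) * 1"
        using f by (intro mult_left_mono) (auto simp: S_def)
      then show ?thesis
        using True by (simp add: algebra_simps)
    next
      case False
      then have "(pmf M x - pmf N x) * f x \<le> 0"
        using f by (intro mult_nonpos_nonneg) (auto simp: S_def)
      then show ?thesis
        using False by (simp add: algebra_simps)
    qed
  qed (use f in \<open>auto intro!: Bochner_Integration.integrable_diff int simp: indicator_def\<close>)
  also have "\<dots> = measure_pmf.expectation M (indicat_real S) - measure_pmf.expectation N (indicat_real S)"
    unfolding dens by (subst Bochner_Integration.integral_diff) (auto intro!: int simp: indicator_def)
  also have "\<dots> = measure_pmf.prob M S - measure_pmf.prob N S"
    by simp
  also have "\<dots> \<le> e"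
    by (rule prob_diff_le_finite[OF fin])
  finally show ?thesis .
qed

text \<open>The value \<open>[]\<close> on non-constants is a dummy: it lets a kernel on strings be
  written as a function on all terms.\<close>

fun str_of :: "tm \<Rightarrow> bitstring" where
  "str_of (Const m) = m"
| "str_of _ = []"

lemma map_Const_str_of:
  assumes "\<And>w. w \<in> set_pmf D \<Longrightarrow> \<exists>m. w = Const m"
  shows "map_pmf Const (map_pmf str_of D) = D"
proof -
  have "map_pmf Const (map_pmf str_of D) = map_pmf (\<lambda>w. w) D"
    unfolding map_pmf_comp by (rule map_pmf_cong) (use assms in force)+
  then show ?thesis by simp
qed

section \<open>Reducibility\<close>

text \<open>
  \<open>near\<close> unfolds the traces of the trace distance, but passes reducible values where traces pass
  typable ones: a passed value is not a subterm, so its reducibility is not available in the induction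
  that proves typable terms reducible. Reducible values are typable by definition, hence \<open>near\<close> is
  never harder to establish than a bound on the trace distance.
\<close>

fun red_val :: "ty \<Rightarrow> tm \<Rightarrow> bool"
  and near :: "ty \<Rightarrow> real \<Rightarrow> tm pmf \<Rightarrow> tm pmf \<Rightarrow> bool"
where
  "red_val Str v \<longleftrightarrow> (\<exists>m. v = Const m)"
| "red_val (Arr a A B) v \<longleftrightarrow> (\<turnstile> v : Arr a A B) \<and> (\<exists>a' A' r. v = Lam a' A' r \<and>
     (\<forall>w. red_val A w \<longrightarrow> (\<exists>D. subst 0 w r \<Down> D \<and> (\<forall>x \<in> set_pmf D. red_val B x)))) \<and>
     (\<forall>e D D'. (\<forall>w \<in> set_pmf D \<union> set_pmf D'. red_val A w) \<longrightarrow> near A e D D' \<longrightarrow>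
        near B e (bind_pmf D (\<lambda>w. pass_value w v)) (bind_pmf D' (\<lambda>w. pass_value w v)))"
| "near Str e D D' \<longleftrightarrow> 0 \<le> e \<and> (\<forall>M. finite M \<longrightarrow> \<bar>view M D - view M D'\<bar> \<le> e)"
| "near (Arr a A B) e D D' \<longleftrightarrow> 0 \<le> e \<and>
     (\<forall>v. red_val A v \<longrightarrow> near B e (bind_pmf D (pass_value v)) (bind_pmf D' (pass_value v)))"

text \<open>With \<open>0 \<le> e\<close> built into both clauses of \<open>near\<close> this is
  immediate; at arrow type it would otherwise require exhibiting a reducible argument.\<close>

lemma near_nonneg: "near A e D D' \<Longrightarrow> 0 \<le> e"
  by (cases A) auto

lemma near_refl: "0 \<le> e \<Longrightarrow> near A e D D"
  by (induction A arbitrary: D) auto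

text \<open>Convexity. Passing a value commutes with mixing, so the arrow case reduces to strings,
  where the difference of the mixtures is an average of differences.\<close>

lemma near_bind:
  assumes "0 \<le> e" and "\<And>w. w \<in> set_pmf P \<Longrightarrow> near B e (F w) (F' w)"
  shows "near B e (bind_pmf P F) (bind_pmf P F')"
  using assms(2)
proof (induction B arbitrary: F F')
  case Str
  have "\<bar>view M (bind_pmf P F) - view M (bind_pmf P F')\<bar> \<le> e" if M: "finite M" for M
  proof -
    have "\<bar>view M (bind_pmf P F) - view M (bind_pmf P F')\<bar>
        = \<bar>measure_pmf.expectation P (\<lambda>w. view M (F w) - view M (F' w))\<bar>"
      by (simp add: view_bind Bochner_Integration.integral_diff integrable_view)
    also have "\<dots> \<le> measure_pmf.expectation P (\<lambda>w. \<bar>view M (F w) - view M (F' w)\<bar>)"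
      by (rule integral_abs_bound)
    also have "\<dots> \<le> e"
      by (rule measure_pmf.integral_le_const)
        (use Str M in \<open>auto simp: AE_measure_pmf_iff integrable_view\<close>)
    finally show ?thesis .
  qed
  then show ?case
    using assms(1) by simp
next
  case (Arr a A B)
  then show ?case
    using assms(1) by (auto simp: bind_assoc_pmf)
qed

text \<open>Data processing: viewing the output of the kernel \<open>F\<close> is a [0,1]-valued
  test of its input. At arrow type the passed value is absorbed into the kernel.\<close>

lemma near_Str_bind:
  assumes near: "near Str e D D'"
    and D: "\<And>w. w \<in> set_pmf D \<Longrightarrow> \<exists>m. w = Const m"
    and D': "\<And>w. w \<in> set_pmf D' \<Longrightarrow> \<exists>m. w = Const m"
  shows "near B e (bind_pmf D F) (bind_pmf D' F)"
proof (induction B arbitrary: F)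
  case Str
  \<comment> \<open>Pulled back to bit strings, whose type is countable as
    \<open>expectation_diff_le\<close> demands.\<close>
  define N N' where "N = map_pmf str_of D" and "N' = map_pmf str_of D'"
  have N: "D = map_pmf Const N" "D' = map_pmf Const N'"
    unfolding N_def N'_def using map_Const_str_of D D' by metis+
  have diff: "\<bar>measure_pmf.prob N X - measure_pmf.prob N' X\<bar> \<le> e" if "finite X" for X
  proof -
    have "\<bar>view X D - view X D'\<bar> \<le> e"
      using near that by simp
    then show ?thesis
      using that by (simp add: view_eq_prob N inj_def inj_vimage_image_eq)
  qed
  have "\<bar>view M (bind_pmf D F) - view M (bind_pmf D' F)\<bar> \<le> e" for M
  proof -
    have "measure_pmf.expectation N (\<lambda>m. view M (F (Const m)))
      - measure_pmf.expectation N' (\<lambda>m. view M (F (Const m))) \<le> e"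
      by (rule expectation_diff_le) (use diff in \<open>auto simp: view_nonneg view_le_1 abs_le_iff\<close>)
    moreover have "measure_pmf.expectation N' (\<lambda>m. view M (F (Const m)))
      - measure_pmf.expectation N (\<lambda>m. view M (F (Const m))) \<le> e"
      by (rule expectation_diff_le) (use diff in \<open>auto simp: view_nonneg view_le_1 abs_le_iff\<close>)
    ultimately show ?thesis
      by (simp add: view_bind N abs_le_iff)
  qed
  then show ?case
    using near by simp
next
  case (Arr a A B)
  then show ?case
    using near_nonneg[OF near] by (simp add: bind_assoc_pmf)
qed

section \<open>Reducible terms and their semantics\<close>

definition red_tm :: "ty \<Rightarrow> tm \<Rightarrow> bool" where
  "red_tm A t \<longleftrightarrow> (\<exists>D. t \<Down> D \<and> (\<forall>v \<in> set_pmf D. red_val A v))"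

lemma sem_eqI: "t \<Down> D \<Longrightarrow> \<lbrakk>t\<rbrakk> = D"
  unfolding sem_def by (rule the_equality) (auto intro: eval_unique)

lemma red_tm_eval: "red_tm A t \<Longrightarrow> t \<Down> \<lbrakk>t\<rbrakk>"
  using sem_eqI by (auto simp: red_tm_def)

lemma red_tm_sem: "red_tm A t \<Longrightarrow> v \<in> set_pmf \<lbrakk>t\<rbrakk> \<Longrightarrow> red_val A v"
  using sem_eqI by (auto simp: red_tm_def)

lemma red_tmI: "t \<Down> D \<Longrightarrow> (\<And>v. v \<in> set_pmf D \<Longrightarrow> red_val A v) \<Longrightarrow> red_tm A t"
  by (auto simp: red_tm_def)

lemma red_val_is_value: "red_val A v \<Longrightarrow> is_value v"
  by (cases A) (auto intro: is_value.intros)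

lemma red_val_typed: "red_val A v \<Longrightarrow> \<turnstile> v : A"
  by (cases A) (auto intro: T_Const)

lemma sem_value: "is_value v \<Longrightarrow> \<lbrakk>v\<rbrakk> = return_pmf v"
  by (intro sem_eqI E_Value)

lemma red_val_red_tm: "red_val A v \<Longrightarrow> red_tm A v"
  by (rule red_tmI[OF E_Value[OF red_val_is_value]]) auto

text \<open>The two claims need each other: reducibility at an arrow type refers to
  \<open>near\<close> at the argument type, and \<open>near\<close> at an arrow type quantifies over
  reducible arguments. Contravariance then calls for both at the argument type.\<close>

lemma red_near_subty:
  assumes "subty A B"
  shows "(red_val A v \<longrightarrow> red_val B v) \<and> (near A e D D' \<longrightarrow> near B e D D')"
  using assms
proof (induction arbitrary: v e D D' rule: subty.induct)
  case (subty_arr B A C C' a b)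
  have BA: "red_val B w \<Longrightarrow> red_val A w" "near B d P P' \<Longrightarrow> near A d P P'" for w d P P'
    using subty_arr.IH(1) by blast+
  have CC': "red_val C w \<Longrightarrow> red_val C' w" "near C d P P' \<Longrightarrow> near C' d P P'" for w d P P'
    using subty_arr.IH(2) by blast+
  have "red_val (Arr b B C') v" if v: "red_val (Arr a A C) v" for v
  proof -
    have sub: "subty (Arr a A C) (Arr b B C')"
      using subty_arr.hyps by (intro subty.subty_arr)
    obtain a' A' r where lam: "v = Lam a' A' r"
      and ev: "\<And>w. red_val A w \<Longrightarrow> \<exists>D. subst 0 w r \<Down> D \<and> (\<forall>x \<in> set_pmf D. red_val C x)"
      using v by auto
    have ne: "near C e (bind_pmf P (\<lambda>w. pass_value w v)) (bind_pmf P' (\<lambda>w. pass_value w v))"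
      if "\<forall>w \<in> set_pmf P \<union> set_pmf P'. red_val A w" "near A e P P'" for e P P'
      using v that unfolding red_val.simps by blast
    have ev': "\<exists>E. subst 0 w r \<Down> E \<and> (\<forall>x \<in> set_pmf E. red_val C' x)" if "red_val B w" for w
      using ev[OF BA(1)[OF that]] CC'(1) by blast
    have ne': "near C' e (bind_pmf P (\<lambda>w. pass_value w v)) (bind_pmf P' (\<lambda>w. pass_value w v))"
      if "\<forall>w \<in> set_pmf P \<union> set_pmf P'. red_val B w" "near B e P P'" for e P P'
      using that BA by (intro CC'(2) ne) auto
    have "\<turnstile> v : Arr b B C'"
      using v sub by (auto intro: T_Sub)
    then show ?thesis
      unfolding red_val.simps using lam ev' ne' by blast
  qed
  then show ?case
    using BA(1) CC'(2) by (auto simp del: red_val.simps)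
qed auto

lemmas red_val_subty = red_near_subty[THEN conjunct1, rule_format]
lemmas near_subty = red_near_subty[THEN conjunct2, rule_format]

lemma red_tm_subty: "subty A B \<Longrightarrow> red_tm A t \<Longrightarrow> red_tm B t"
  using red_val_subty by (auto simp: red_tm_def)

lemma red_Const: "red_tm Str (Const m)"
  by (intro red_val_red_tm) auto

lemma red_Rand: "red_tm Str Rand"
  by (rule red_tmI[OF E_Rand]) auto

lemma red_tm_Str_eval:
  assumes "red_tm Str t"
  shows "t \<Down> map_pmf Const (map_pmf str_of \<lbrakk>t\<rbrakk>)"
  using red_tm_eval[OF assms] red_tm_sem[OF assms] by (subst map_Const_str_of) auto

text \<open>Expressing application through \<open>pass_value\<close> makes it one step of a trace,
  the form in which \<open>near\<close> is defined.\<close>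

lemma red_App:
  assumes t: "red_tm (Arr a A B) t" and s: "red_tm A s"
  shows "\<lbrakk>App t s\<rbrakk> = bind_pmf \<lbrakk>t\<rbrakk> (\<lambda>u. bind_pmf \<lbrakk>s\<rbrakk> (\<lambda>w. pass_value w u))" (is ?sem)
    and "red_tm B (App t s)"
proof -
  have red: "red_tm B (subst 0 w r)" if "Lam a' A' r \<in> set_pmf \<lbrakk>t\<rbrakk>" "w \<in> set_pmf \<lbrakk>s\<rbrakk>" for a' A' r w
    using red_tm_sem[OF t that(1)] red_tm_sem[OF s that(2)] by (auto simp: red_tm_def)
  have lam: "\<exists>a' A' r. u = Lam a' A' r" if "u \<in> set_pmf \<lbrakk>t\<rbrakk>" for u
    using red_tm_sem[OF t that] by auto
  have ev: "App t s \<Down> bind_pmf \<lbrakk>t\<rbrakk> (\<lambda>u. bind_pmf \<lbrakk>s\<rbrakk> (\<lambda>w. pass_value w u))"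
    by (rule E_App[OF red_tm_eval[OF t] red_tm_eval[OF s] lam])
      (auto intro!: red_tm_eval[OF red])
  then show ?sem
    by (rule sem_eqI)
  show "red_tm B (App t s)"
  proof (rule red_tmI[OF ev])
    fix v assume "v \<in> set_pmf (bind_pmf \<lbrakk>t\<rbrakk> (\<lambda>u. bind_pmf \<lbrakk>s\<rbrakk> (\<lambda>w. pass_value w u)))"
    then show "red_val B v"
      using lam red red_tm_sem by fastforce
  qed
qed

text \<open>The semantics is put as a fixed kernel applied to the distribution of \<open>t\<close>,
  ready for data processing; the other string consumers follow the same pattern.\<close>

lemma red_Push0:
  assumes "red_tm Str t"
  shows "\<lbrakk>Push0 t\<rbrakk> = bind_pmf \<lbrakk>t\<rbrakk> (\<lambda>w. return_pmf (Const (False # str_of w)))"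
    and "red_tm Str (Push0 t)"
  using E_Push0[OF red_tm_Str_eval[OF assms]]
  by (auto intro!: sem_eqI red_tmI simp: map_pmf_def bind_assoc_pmf bind_return_pmf)

lemma red_Push1:
  assumes "red_tm Str t"
  shows "\<lbrakk>Push1 t\<rbrakk> = bind_pmf \<lbrakk>t\<rbrakk> (\<lambda>w. return_pmf (Const (True # str_of w)))"
    and "red_tm Str (Push1 t)"
  using E_Push1[OF red_tm_Str_eval[OF assms]]
  by (auto intro!: sem_eqI red_tmI simp: map_pmf_def bind_assoc_pmf bind_return_pmf)

lemma red_Tail:
  assumes "red_tm Str t"
  shows "\<lbrakk>Tail t\<rbrakk> = bind_pmf \<lbrakk>t\<rbrakk> (\<lambda>w. return_pmf (Const (tl (str_of w))))"
    and "red_tm Str (Tail t)"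
  using E_Tail[OF red_tm_Str_eval[OF assms]]
  by (auto intro!: sem_eqI red_tmI simp: map_pmf_def bind_assoc_pmf bind_return_pmf)

lemma red_Case:
  assumes t: "red_tm Str t" and br: "red_tm A t0" "red_tm A t1" "red_tm A te"
  shows "\<lbrakk>Case A' t t0 t1 te\<rbrakk> = bind_pmf \<lbrakk>t\<rbrakk> (\<lambda>w. \<lbrakk>case_branch t0 t1 te (str_of w)\<rbrakk>)"
    and "red_tm A (Case A' t t0 t1 te)"
proof -
  have red: "red_tm A (case_branch t0 t1 te m)" for m
    using br by (cases m) auto
  have ev: "Case A' t t0 t1 te \<Down> bind_pmf \<lbrakk>t\<rbrakk> (\<lambda>w. \<lbrakk>case_branch t0 t1 te (str_of w)\<rbrakk>)"
    using E_Case[OF red_tm_Str_eval[OF t] red_tm_eval[OF red], of A']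
    by (simp add: map_pmf_def bind_assoc_pmf bind_return_pmf)
  then show "\<lbrakk>Case A' t t0 t1 te\<rbrakk> = bind_pmf \<lbrakk>t\<rbrakk> (\<lambda>w. \<lbrakk>case_branch t0 t1 te (str_of w)\<rbrakk>)"
    by (rule sem_eqI)
  show "red_tm A (Case A' t t0 t1 te)"
    by (rule red_tmI[OF ev]) (use red red_tm_sem in auto)
qed

lemma red_Rec_Const:
  assumes "red_tm A (rec_unfold A t0 t1 te m)"
  shows "\<lbrakk>Rec A (Const m) t0 t1 te\<rbrakk> = \<lbrakk>rec_unfold A t0 t1 te m\<rbrakk>"
    and "red_tm A (Rec A (Const m) t0 t1 te)"
proof -
  have "Const m \<Down> map_pmf Const (return_pmf m)"
    using E_Value[OF is_value.intros(1)[of m]] by simp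
  then have ev: "Rec A (Const m) t0 t1 te \<Down> bind_pmf (return_pmf m) (\<lambda>m. \<lbrakk>rec_unfold A t0 t1 te m\<rbrakk>)"
    by (rule E_Rec) (use red_tm_eval[OF assms] in auto)
  then show "\<lbrakk>Rec A (Const m) t0 t1 te\<rbrakk> = \<lbrakk>rec_unfold A t0 t1 te m\<rbrakk>"
    by (intro sem_eqI) (simp add: bind_return_pmf)
  show "red_tm A (Rec A (Const m) t0 t1 te)"
    by (rule red_tmI[OF ev]) (use red_tm_sem[OF assms] in \<open>auto simp: bind_return_pmf\<close>)
qed

text \<open>Recursion descends along a string that is already evaluated, so induction on that string
  gives termination.\<close>

lemma red_rec_unfold:
  assumes br: "red_tm (Arr White Str (Arr Black A A)) t0" "red_tm (Arr White Str (Arr Black A A)) t1"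
    and te: "red_tm A te"
  shows "red_tm A (rec_unfold A t0 t1 te m)"
proof (induction m)
  case (Cons b m)
  then show ?case
    using br by (auto intro!: red_App(2) red_Rec_Const(2) red_Const)
qed (simp add: te)

lemma red_Rec:
  assumes t: "red_tm Str t"
    and br: "red_tm (Arr White Str (Arr Black A A)) t0" "red_tm (Arr White Str (Arr Black A A)) t1"
    and te: "red_tm A te"
  shows "\<lbrakk>Rec A t t0 t1 te\<rbrakk> = bind_pmf \<lbrakk>t\<rbrakk> (\<lambda>w. \<lbrakk>rec_unfold A t0 t1 te (str_of w)\<rbrakk>)"
    and "red_tm A (Rec A t t0 t1 te)"
proof -
  note red = red_rec_unfold[OF br te]
  have ev: "Rec A t t0 t1 te \<Down> bind_pmf \<lbrakk>t\<rbrakk> (\<lambda>w. \<lbrakk>rec_unfold A t0 t1 te (str_of w)\<rbrakk>)"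
    using E_Rec[OF red_tm_Str_eval[OF t] red_tm_eval[OF red]]
    by (simp add: map_pmf_def bind_assoc_pmf bind_return_pmf)
  then show "\<lbrakk>Rec A t t0 t1 te\<rbrakk> = bind_pmf \<lbrakk>t\<rbrakk> (\<lambda>w. \<lbrakk>rec_unfold A t0 t1 te (str_of w)\<rbrakk>)"
    by (rule sem_eqI)
  show "red_tm A (Rec A t t0 t1 te)"
    by (rule red_tmI[OF ev]) (use red red_tm_sem in auto)
qed

section \<open>Nonexpanding families of terms\<close>

text \<open>
  The family \<open>f\<close> is evaluated at an index drawn from \<open>D\<close> or from \<open>D'\<close>. Taking point distributions gives
  two terms plugged in a context; taking distributions of values gives a free variable.
\<close>

definition nonexp :: "'i pmf \<Rightarrow> 'i pmf \<Rightarrow> real \<Rightarrow> ty \<Rightarrow> ('i \<Rightarrow> tm) \<Rightarrow> bool" where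
  "nonexp D D' e B f \<longleftrightarrow> (\<forall>u \<in> set_pmf D \<union> set_pmf D'. red_tm B (f u)) \<and>
     near B e (bind_pmf D (\<lambda>u. \<lbrakk>f u\<rbrakk>)) (bind_pmf D' (\<lambda>u. \<lbrakk>f u\<rbrakk>))"

lemma nonexp_red: "nonexp D D' e B f \<Longrightarrow> u \<in> set_pmf D \<union> set_pmf D' \<Longrightarrow> red_tm B (f u)"
  by (auto simp: nonexp_def)

lemma nonexp_near: "nonexp D D' e B f \<Longrightarrow> near B e (bind_pmf D (\<lambda>u. \<lbrakk>f u\<rbrakk>)) (bind_pmf D' (\<lambda>u. \<lbrakk>f u\<rbrakk>))"
  by (auto simp: nonexp_def)

lemma nonexp_nonneg: "nonexp D D' e B f \<Longrightarrow> 0 \<le> e"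
  by (auto simp: nonexp_def dest: near_nonneg)

lemma nonexpI:
  assumes "\<And>u. u \<in> set_pmf D \<union> set_pmf D' \<Longrightarrow> red_tm B (f u)"
    and "\<And>u. u \<in> set_pmf D \<union> set_pmf D' \<Longrightarrow> \<lbrakk>f u\<rbrakk> = F u"
    and "near B e (bind_pmf D F) (bind_pmf D' F)"
  shows "nonexp D D' e B f"
proof -
  have "bind_pmf D (\<lambda>u. \<lbrakk>f u\<rbrakk>) = bind_pmf D F" "bind_pmf D' (\<lambda>u. \<lbrakk>f u\<rbrakk>) = bind_pmf D' F"
    using assms(2) by (auto intro!: bind_pmf_cong)
  then show ?thesis
    using assms by (simp add: nonexp_def)
qed

text \<open>Both mixtures of a constant family coincide. The forward direction later extracts
  reducibility of a term in which the varying variable does not occur.\<close>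

lemma nonexp_const: "nonexp D D' e B (\<lambda>_. t) \<longleftrightarrow> 0 \<le> e \<and> red_tm B t"
proof
  obtain u where "u \<in> set_pmf D"
    using set_pmf_not_empty by fast
  then show "nonexp D D' e B (\<lambda>_. t) \<Longrightarrow> 0 \<le> e \<and> red_tm B t"
    using nonexp_red[of D D' e B "\<lambda>_. t" u] nonexp_nonneg by auto
qed (auto simp: nonexp_def near_refl)

lemma nonexp_subty: "subty A B \<Longrightarrow> nonexp D D' e A f \<Longrightarrow> nonexp D D' e B f"
  using red_tm_subty near_subty by (auto simp: nonexp_def)

text \<open>The value \<open>w\<close> of the fixed argument is drawn first; \<open>near\<close> at
  arrow type is by definition stable under passing \<open>w\<close>, and \<open>near_bind\<close>
  averages over \<open>w\<close>.\<close>

lemma nonexp_AppL: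
  assumes f: "nonexp D D' e (Arr a A B) f" and s: "red_tm A s"
  shows "nonexp D D' e B (\<lambda>u. App (f u) s)"
proof (rule nonexpI)
  fix u assume u: "u \<in> set_pmf D \<union> set_pmf D'"
  show "red_tm B (App (f u) s)"
    by (rule red_App(2)[OF nonexp_red[OF f u] s])
  show "\<lbrakk>App (f u) s\<rbrakk> = bind_pmf \<lbrakk>s\<rbrakk> (\<lambda>w. bind_pmf \<lbrakk>f u\<rbrakk> (pass_value w))"
    unfolding red_App(1)[OF nonexp_red[OF f u] s] by (subst bind_commute_pmf) simp
next
  have "near B e (bind_pmf \<lbrakk>s\<rbrakk> (\<lambda>w. bind_pmf (bind_pmf D (\<lambda>u. \<lbrakk>f u\<rbrakk>)) (pass_value w)))
          (bind_pmf \<lbrakk>s\<rbrakk> (\<lambda>w. bind_pmf (bind_pmf D' (\<lambda>u. \<lbrakk>f u\<rbrakk>)) (pass_value w)))"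
    using nonexp_near[OF f] red_tm_sem[OF s] nonexp_nonneg[OF f] by (intro near_bind) auto
  then show "near B e (bind_pmf D (\<lambda>u. bind_pmf \<lbrakk>s\<rbrakk> (\<lambda>w. bind_pmf \<lbrakk>f u\<rbrakk> (pass_value w))))
          (bind_pmf D' (\<lambda>u. bind_pmf \<lbrakk>s\<rbrakk> (\<lambda>w. bind_pmf \<lbrakk>f u\<rbrakk> (pass_value w))))"
    by (simp add: bind_assoc_pmf bind_commute_pmf[of _ "\<lbrakk>s\<rbrakk>"])
qed

text \<open>The value \<open>x\<close> of the fixed function is drawn first; its reducibility
  contains exactly the required bound for two distributions of arguments.\<close>

lemma nonexp_AppR:
  assumes t: "red_tm (Arr a A B) t" and f: "nonexp D D' e A f"
  shows "nonexp D D' e B (\<lambda>u. App t (f u))"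
proof (rule nonexpI)
  fix u assume u: "u \<in> set_pmf D \<union> set_pmf D'"
  show "red_tm B (App t (f u))"
    by (rule red_App(2)[OF t nonexp_red[OF f u]])
  show "\<lbrakk>App t (f u)\<rbrakk> = bind_pmf \<lbrakk>t\<rbrakk> (\<lambda>x. bind_pmf \<lbrakk>f u\<rbrakk> (\<lambda>w. pass_value w x))"
    by (rule red_App(1)[OF t nonexp_red[OF f u]])
next
  have red: "\<forall>w \<in> set_pmf (bind_pmf D (\<lambda>u. \<lbrakk>f u\<rbrakk>)) \<union> set_pmf (bind_pmf D' (\<lambda>u. \<lbrakk>f u\<rbrakk>)). red_val A w"
    using red_tm_sem nonexp_red[OF f] by fastforce
  have "near B e (bind_pmf \<lbrakk>t\<rbrakk> (\<lambda>x. bind_pmf (bind_pmf D (\<lambda>u. \<lbrakk>f u\<rbrakk>)) (\<lambda>w. pass_value w x)))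
          (bind_pmf \<lbrakk>t\<rbrakk> (\<lambda>x. bind_pmf (bind_pmf D' (\<lambda>u. \<lbrakk>f u\<rbrakk>)) (\<lambda>w. pass_value w x)))"
  proof (rule near_bind[OF nonexp_nonneg[OF f]])
    fix x assume "x \<in> set_pmf \<lbrakk>t\<rbrakk>"
    then have "red_val (Arr a A B) x"
      by (rule red_tm_sem[OF t])
    then show "near B e (bind_pmf (bind_pmf D (\<lambda>u. \<lbrakk>f u\<rbrakk>)) (\<lambda>w. pass_value w x))
      (bind_pmf (bind_pmf D' (\<lambda>u. \<lbrakk>f u\<rbrakk>)) (\<lambda>w. pass_value w x))"
      using red nonexp_near[OF f] unfolding red_val.simps by blast
  qed
  then show "near B e (bind_pmf D (\<lambda>u. bind_pmf \<lbrakk>t\<rbrakk> (\<lambda>x. bind_pmf \<lbrakk>f u\<rbrakk> (\<lambda>w. pass_value w x))))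
          (bind_pmf D' (\<lambda>u. bind_pmf \<lbrakk>t\<rbrakk> (\<lambda>x. bind_pmf \<lbrakk>f u\<rbrakk> (\<lambda>w. pass_value w x))))"
    by (simp add: bind_assoc_pmf bind_commute_pmf[of _ "\<lbrakk>t\<rbrakk>"])
qed

lemma nonexp_bind_Str:
  assumes f: "nonexp D D' e Str f"
    and g: "\<And>u. u \<in> set_pmf D \<union> set_pmf D' \<Longrightarrow> red_tm B (g u)"
      "\<And>u. u \<in> set_pmf D \<union> set_pmf D' \<Longrightarrow> \<lbrakk>g u\<rbrakk> = bind_pmf \<lbrakk>f u\<rbrakk> F"
  shows "nonexp D D' e B g"
proof (rule nonexpI[OF g])
  have "near B e (bind_pmf (bind_pmf D (\<lambda>u. \<lbrakk>f u\<rbrakk>)) F) (bind_pmf (bind_pmf D' (\<lambda>u. \<lbrakk>f u\<rbrakk>)) F)"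
  proof (rule near_Str_bind[OF nonexp_near[OF f]])
    show "\<exists>m. w = Const m" if "w \<in> set_pmf (bind_pmf D (\<lambda>u. \<lbrakk>f u\<rbrakk>))" for w
      using that red_tm_sem[OF nonexp_red[OF f]] by fastforce
    show "\<exists>m. w = Const m" if "w \<in> set_pmf (bind_pmf D' (\<lambda>u. \<lbrakk>f u\<rbrakk>))" for w
      using that red_tm_sem[OF nonexp_red[OF f]] by fastforce
  qed
  then show "near B e (bind_pmf D (\<lambda>u. bind_pmf \<lbrakk>f u\<rbrakk> F)) (bind_pmf D' (\<lambda>u. bind_pmf \<lbrakk>f u\<rbrakk> F))"
    by (simp add: bind_assoc_pmf)
qed

lemma nonexp_values:
  assumes "\<And>u. u \<in> set_pmf D \<union> set_pmf D' \<Longrightarrow> red_val A u" and "near A e D D'"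
  shows "nonexp D D' e A (\<lambda>u. u)"
  using assms by (intro nonexpI[where F = return_pmf] red_val_red_tm sem_value)
    (auto simp: bind_return_pmf' intro: red_val_is_value)

text \<open>On string values the whole map from \<open>u\<close> to the semantics of
  \<open>g u\<close> is one kernel, however often \<open>g\<close> copies \<open>u\<close>.\<close>

lemma nonexp_Str_values:
  assumes "\<And>u. u \<in> set_pmf D \<union> set_pmf D' \<Longrightarrow> red_val Str u" and "near Str e D D'"
    and g: "\<And>u. u \<in> set_pmf D \<union> set_pmf D' \<Longrightarrow> red_tm B (g u)"
  shows "nonexp D D' e B g"
proof (rule nonexp_bind_Str[OF nonexp_values[OF assms(1,2)] g])
  show "\<lbrakk>g u\<rbrakk> = bind_pmf \<lbrakk>u\<rbrakk> (\<lambda>u. \<lbrakk>g u\<rbrakk>)" if "u \<in> set_pmf D \<union> set_pmf D'" for u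
    by (simp only: sem_value[OF red_val_is_value[OF assms(1)[OF that]]] bind_return_pmf)
qed

lemma nonexp_Push0: "nonexp D D' e Str f \<Longrightarrow> nonexp D D' e Str (\<lambda>u. Push0 (f u))"
  by (rule nonexp_bind_Str) (auto intro!: red_Push0 dest: nonexp_red)

lemma nonexp_Push1: "nonexp D D' e Str f \<Longrightarrow> nonexp D D' e Str (\<lambda>u. Push1 (f u))"
  by (rule nonexp_bind_Str) (auto intro!: red_Push1 dest: nonexp_red)

lemma nonexp_Tail: "nonexp D D' e Str f \<Longrightarrow> nonexp D D' e Str (\<lambda>u. Tail (f u))"
  by (rule nonexp_bind_Str) (auto intro!: red_Tail dest: nonexp_red)

lemma nonexp_Case_scrutinee:
  assumes "nonexp D D' e Str f" "red_tm A t0" "red_tm A t1" "red_tm A te"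
  shows "nonexp D D' e A (\<lambda>u. Case A' (f u) t0 t1 te)"
  by (rule nonexp_bind_Str[OF assms(1)]) (use assms in \<open>auto intro!: red_Case dest: nonexp_red\<close>)

lemma nonexp_Rec_scrutinee:
  assumes "nonexp D D' e Str f"
    "red_tm (Arr White Str (Arr Black A A)) t0" "red_tm (Arr White Str (Arr Black A A)) t1"
    "red_tm A te"
  shows "nonexp D D' e A (\<lambda>u. Rec A (f u) t0 t1 te)"
  by (rule nonexp_bind_Str[OF assms(1)]) (use assms in \<open>auto intro!: red_Rec dest: nonexp_red\<close>)

lemma nonexp_mixture:
  assumes g: "\<And>u. u \<in> set_pmf D \<union> set_pmf D' \<Longrightarrow> red_tm B (g u)"
      "\<And>u. u \<in> set_pmf D \<union> set_pmf D' \<Longrightarrow> \<lbrakk>g u\<rbrakk> = bind_pmf P (\<lambda>w. \<lbrakk>h w u\<rbrakk>)"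
    and h: "\<And>w. nonexp D D' e B (h w)"
  shows "nonexp D D' e B g"
proof (rule nonexpI[OF g])
  have "near B e (bind_pmf P (\<lambda>w. bind_pmf D (\<lambda>u. \<lbrakk>h w u\<rbrakk>))) (bind_pmf P (\<lambda>w. bind_pmf D' (\<lambda>u. \<lbrakk>h w u\<rbrakk>)))"
    using h nonexp_nonneg by (intro near_bind nonexp_near) blast+
  then show "near B e (bind_pmf D (\<lambda>u. bind_pmf P (\<lambda>w. \<lbrakk>h w u\<rbrakk>)))
      (bind_pmf D' (\<lambda>u. bind_pmf P (\<lambda>w. \<lbrakk>h w u\<rbrakk>)))"
    by (simp add: bind_commute_pmf[of _ P])
qed

text \<open>Only one branch runs for each outcome of \<open>t\<close>, so the errors of three
  varying branches do not add up.\<close>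

lemma nonexp_Case_branches:
  assumes t: "red_tm Str t"
    and f: "nonexp D D' e A f0" "nonexp D D' e A f1" "nonexp D D' e A fe"
  shows "nonexp D D' e A (\<lambda>u. Case A' t (f0 u) (f1 u) (fe u))"
proof (rule nonexp_mixture)
  fix u assume u: "u \<in> set_pmf D \<union> set_pmf D'"
  note red = red_Case[OF t f[THEN nonexp_red, OF u]]
  show "red_tm A (Case A' t (f0 u) (f1 u) (fe u))"
    by (rule red(2))
  show "\<lbrakk>Case A' t (f0 u) (f1 u) (fe u)\<rbrakk>
    = bind_pmf \<lbrakk>t\<rbrakk> (\<lambda>w. \<lbrakk>case_branch (f0 u) (f1 u) (fe u) (str_of w)\<rbrakk>)"
    by (rule red(1))
next
  show "nonexp D D' e A (\<lambda>u. case_branch (f0 u) (f1 u) (fe u) (str_of w))" for w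
    using f by (cases "str_of w"; cases "hd (str_of w)"; simp)
qed

text \<open>The varying base case occurs once, innermost; each bit of \<open>m\<close> wraps around
  it an application of a function that does not depend on \<open>u\<close>.\<close>

lemma nonexp_rec_unfold:
  assumes br: "red_tm (Arr White Str (Arr Black A A)) t0" "red_tm (Arr White Str (Arr Black A A)) t1"
    and f: "nonexp D D' e A f"
  shows "nonexp D D' e A (\<lambda>u. rec_unfold A t0 t1 (f u) m)"
proof (induction m)
  case (Cons b m)
  have "nonexp D D' e A (\<lambda>u. Rec A (Const m) t0 t1 (f u))"
    by (rule nonexpI[OF _ _ nonexp_near[OF Cons]])
      (use nonexp_red[OF Cons] in \<open>auto intro!: red_Rec_Const\<close>)
  moreover have "red_tm (Arr Black A A) (App (if b then t1 else t0) (Const (b # m)))"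
    using br by (auto intro!: red_App(2) red_Const)
  ultimately show ?case
    by (simp add: nonexp_AppR del: if_split)
qed (simp add: f)

lemma nonexp_Rec_base:
  assumes t: "red_tm Str t"
    and br: "red_tm (Arr White Str (Arr Black A A)) t0" "red_tm (Arr White Str (Arr Black A A)) t1"
    and f: "nonexp D D' e A f"
  shows "nonexp D D' e A (\<lambda>u. Rec A t t0 t1 (f u))"
  by (rule nonexp_mixture[OF _ _ nonexp_rec_unfold[OF br f]])
    (use red_Rec[OF t br] nonexp_red[OF f] in auto)

section \<open>Substitution\<close>

lemma map_le_iff: "E \<subseteq>\<^sub>m F \<longleftrightarrow> (\<forall>i d. E i = Some d \<longrightarrow> F i = Some d)"
  by (force simp: map_le_def)

lemma disjoint_envs_nth_None:
  "disjoint_envs Es \<Longrightarrow> sorted_wrt (\<lambda>E F. E i = None \<or> F i = None) Es"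
  unfolding disjoint_envs_def by (erule sorted_wrt_mono_rel[rotated]) auto

text \<open>By disjointness no declaration is overridden, so assumptions on the variables of a
  conclusion pass to each premise. The next two lemmas do the same for the other branching
  rules.\<close>

lemma disjoint_envs_map_le:
  assumes "disjoint_envs [G, D1, D2]"
  shows "G ++ D1 \<subseteq>\<^sub>m G ++ D1 ++ D2" "G ++ D2 \<subseteq>\<^sub>m G ++ D1 ++ D2"
proof -
  have "((G ++ D1) i = Some d \<longrightarrow> (G ++ D1 ++ D2) i = Some d) \<and>
     ((G ++ D2) i = Some d \<longrightarrow> (G ++ D1 ++ D2) i = Some d)" for i d
    using disjoint_envs_nth_None[OF assms, of i] by (auto simp: map_add_Some_iff)
  then show "G ++ D1 \<subseteq>\<^sub>m G ++ D1 ++ D2" "G ++ D2 \<subseteq>\<^sub>m G ++ D1 ++ D2"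
    by (simp_all add: map_le_iff)
qed

lemma disjoint_envs_map_le_Case:
  assumes "disjoint_envs [G, D1, D2, D3, D4]"
  shows "G ++ D1 \<subseteq>\<^sub>m G ++ D1 ++ D2 ++ D3 ++ D4" "G ++ D2 \<subseteq>\<^sub>m G ++ D1 ++ D2 ++ D3 ++ D4"
    "G ++ D3 \<subseteq>\<^sub>m G ++ D1 ++ D2 ++ D3 ++ D4" "G ++ D4 \<subseteq>\<^sub>m G ++ D1 ++ D2 ++ D3 ++ D4"
proof -
  have "((G ++ D1) i = Some d \<longrightarrow> (G ++ D1 ++ D2 ++ D3 ++ D4) i = Some d) \<and>
     ((G ++ D2) i = Some d \<longrightarrow> (G ++ D1 ++ D2 ++ D3 ++ D4) i = Some d) \<and>
     ((G ++ D3) i = Some d \<longrightarrow> (G ++ D1 ++ D2 ++ D3 ++ D4) i = Some d) \<and>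
     ((G ++ D4) i = Some d \<longrightarrow> (G ++ D1 ++ D2 ++ D3 ++ D4) i = Some d)" for i d
    using disjoint_envs_nth_None[OF assms, of i] by (auto simp: map_add_Some_iff)
  then show "G ++ D1 \<subseteq>\<^sub>m G ++ D1 ++ D2 ++ D3 ++ D4" "G ++ D2 \<subseteq>\<^sub>m G ++ D1 ++ D2 ++ D3 ++ D4"
    "G ++ D3 \<subseteq>\<^sub>m G ++ D1 ++ D2 ++ D3 ++ D4" "G ++ D4 \<subseteq>\<^sub>m G ++ D1 ++ D2 ++ D3 ++ D4"
    by (simp_all add: map_le_iff)
qed

lemma disjoint_envs_map_le_Rec:
  assumes "disjoint_envs [G1, G2, G3, D1, D2]"
  shows "G1 ++ D1 \<subseteq>\<^sub>m G1 ++ G2 ++ G3 ++ D1 ++ D2" "G1 ++ G2 \<subseteq>\<^sub>m G1 ++ G2 ++ G3 ++ D1 ++ D2"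
    "G1 ++ G3 \<subseteq>\<^sub>m G1 ++ G2 ++ G3 ++ D1 ++ D2" "G1 ++ G2 ++ G3 ++ D2 \<subseteq>\<^sub>m G1 ++ G2 ++ G3 ++ D1 ++ D2"
proof -
  have "((G1 ++ D1) i = Some d \<longrightarrow> (G1 ++ G2 ++ G3 ++ D1 ++ D2) i = Some d) \<and>
     ((G1 ++ G2) i = Some d \<longrightarrow> (G1 ++ G2 ++ G3 ++ D1 ++ D2) i = Some d) \<and>
     ((G1 ++ G3) i = Some d \<longrightarrow> (G1 ++ G2 ++ G3 ++ D1 ++ D2) i = Some d) \<and>
     ((G1 ++ G2 ++ G3 ++ D2) i = Some d \<longrightarrow> (G1 ++ G2 ++ G3 ++ D1 ++ D2) i = Some d)" for i d
    using disjoint_envs_nth_None[OF assms, of i] by (auto simp: map_add_Some_iff)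
  then show "G1 ++ D1 \<subseteq>\<^sub>m G1 ++ G2 ++ G3 ++ D1 ++ D2" "G1 ++ G2 \<subseteq>\<^sub>m G1 ++ G2 ++ G3 ++ D1 ++ D2"
    "G1 ++ G3 \<subseteq>\<^sub>m G1 ++ G2 ++ G3 ++ D1 ++ D2" "G1 ++ G2 ++ G3 ++ D2 \<subseteq>\<^sub>m G1 ++ G2 ++ G3 ++ D1 ++ D2"
    by (simp_all add: map_le_iff)
qed

lemma disjoint_envs_restrict: "disjoint_envs Es \<Longrightarrow> disjoint_envs (map (\<lambda>E. E |` S) Es)"
  unfolding disjoint_envs_def sorted_wrt_map by (erule sorted_wrt_mono_rel[rotated]) auto

lemma restrict_map_add: "(E ++ F) |` S = (E |` S) ++ (F |` S)"
  by (rule ext) (simp add: restrict_map_def map_add_def)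

lemma ran_restrict_subset: "ran (E |` S) \<subseteq> ran E"
  by (auto simp: ran_def restrict_map_def split: if_splits)

lemma str_only_restrict: "str_only E \<Longrightarrow> str_only (E |` S)"
  using ran_restrict_subset[of E S] by (auto simp: str_only_def)

lemma env_below_restrict: "env_below E a \<Longrightarrow> env_below (E |` S) a"
  using ran_restrict_subset[of E S] by (auto simp: env_below_def)

lemma ext_restrict: "ext E a A |` {..<Suc k} = ext (E |` {..<k}) a A"
  by (rule ext) (auto simp: ext_def restrict_map_def split: nat.splits)

text \<open>The new declarations go to an unshared part free of side conditions: \<open>D1\<close>
  for application, whose \<open>D2\<close> is bounded by the aspect, and \<open>D2\<close> for
  recursion, whose \<open>D1\<close> is bounded by \<open>White\<close>.\<close>

lemma typing_weaken:
  assumes "E \<turnstile> t : A" and "dom E \<inter> dom F = {}"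
  shows "E ++ F \<turnstile> t : A"
  using assms
proof (induction arbitrary: F rule: typing.induct)
  case (T_Var E i a A)
  then have "F i = None"
    by (meson disjoint_iff domI domIff)
  then show ?case
    using T_Var by (intro typing.T_Var[of _ _ a]) (simp add: map_add_Some_iff)
next
  case (T_Lam E a A t B)
  \<comment> \<open>\<open>case_nat None F\<close> is \<open>F\<close> shifted past the new binder,
    leaving index 0 undeclared.\<close>
  have "ext E a A ++ case_nat None F \<turnstile> t : B"
    using T_Lam.prems by (intro T_Lam.IH) (auto simp: ext_def disjoint_iff domIff split: nat.splits)
  also have "ext E a A ++ case_nat None F = ext (E ++ F) a A"
    by (rule ext) (simp add: ext_def map_add_def split: nat.splits)
  finally show ?case
    by (rule typing.T_Lam)
next
  case (T_App G D1 D2 t a A B s)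
  have comm: "G ++ D1 ++ D2 ++ F = G ++ (D1 ++ F) ++ D2"
  proof
    fix i
    have "F i = None \<or> G i = None \<and> D1 i = None \<and> D2 i = None"
    proof (cases "F i")
      case (Some d)
      then have "i \<notin> dom (G ++ D1 ++ D2)"
        using T_App.prems domI[of F i, OF Some] by (metis disjoint_iff)
      then show ?thesis
        by (simp add: domIff del: split_paired_All split_paired_Ex)
    qed simp
    then show "(G ++ D1 ++ D2 ++ F) i = (G ++ (D1 ++ F) ++ D2) i"
      by (cases "F i") (auto simp: map_add_def split: option.splits)
  qed
  have "disjoint_envs [G, D1 ++ F, D2]"
    using T_App.hyps(2) T_App.prems by (auto simp: disjoint_envs_def)
  moreover have "G ++ (D1 ++ F) \<turnstile> t : Arr a A B"
    using T_App.IH(1)[of F] T_App.prems by (auto simp: Int_Un_distrib2)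
  ultimately show ?case
    unfolding comm using T_App.hyps by (intro typing.T_App)
next
  case (T_Case G D1 D2 D3 D4 t t0 A t1 te)
  have comm: "G ++ D1 ++ D2 ++ D3 ++ D4 ++ F = G ++ (D1 ++ F) ++ D2 ++ D3 ++ D4"
  proof
    fix i
    have "F i = None \<or> G i = None \<and> D1 i = None \<and> D2 i = None \<and> D3 i = None \<and> D4 i = None"
    proof (cases "F i")
      case (Some d)
      then have "i \<notin> dom (G ++ D1 ++ D2 ++ D3 ++ D4)"
        using T_Case.prems domI[of F i, OF Some] by (metis disjoint_iff)
      then show ?thesis
        by (simp add: domIff del: split_paired_All split_paired_Ex)
    qed simp
    then show "(G ++ D1 ++ D2 ++ D3 ++ D4 ++ F) i = (G ++ (D1 ++ F) ++ D2 ++ D3 ++ D4) i"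
      by (cases "F i") (auto simp: map_add_def split: option.splits)
  qed
  have "disjoint_envs [G, D1 ++ F, D2, D3, D4]"
    using T_Case.hyps(2) T_Case.prems by (auto simp: disjoint_envs_def)
  moreover have "G ++ (D1 ++ F) \<turnstile> t : Str"
    using T_Case.IH(1)[of F] T_Case.prems by (auto simp: Int_Un_distrib2)
  ultimately show ?case
    unfolding comm using T_Case.hyps by (intro typing.T_Case)
next
  case (T_Rec G1 G2 G3 D1 D2 t t0 A t1 te)
  have "disjoint_envs [G1, G2, G3, D1, D2 ++ F]"
    using T_Rec.hyps(4) T_Rec.prems by (auto simp: disjoint_envs_def)
  moreover have "G1 ++ G2 ++ G3 ++ (D2 ++ F) \<turnstile> te : A"
    using T_Rec.IH(4)[of F] T_Rec.prems by (auto simp: Int_Un_distrib2)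
  ultimately have "G1 ++ G2 ++ G3 ++ D1 ++ (D2 ++ F) \<turnstile> Rec A t t0 t1 te : A"
    using T_Rec.hyps by (intro typing.T_Rec)
  then show ?case by simp
next
  case (T_Sub E t A B)
  then show ?case
    by (intro typing.T_Sub[OF T_Sub.IH])
qed (auto intro: T_Const T_Push0 T_Push1 T_Tail T_Rand)

lemma closed_typing_weaken: "\<turnstile> t : A \<Longrightarrow> E \<turnstile> t : A"
  using typing_weaken[of Map.empty t A E] by simp

text \<open>Closes a term in one go. \<open>k\<close> counts the binders crossed; the values of
  \<open>g\<close> are meant to be closed, hence are not shifted, and no index is lowered since
  every free one is replaced.\<close>

fun msubst :: "nat \<Rightarrow> (nat \<Rightarrow> tm) \<Rightarrow> tm \<Rightarrow> tm" where
  "msubst k g (Var i) = (if i < k then Var i else g (i - k))"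
| "msubst k g (Const m) = Const m"
| "msubst k g (Lam a A t) = Lam a A (msubst (Suc k) g t)"
| "msubst k g (Push0 t) = Push0 (msubst k g t)"
| "msubst k g (Push1 t) = Push1 (msubst k g t)"
| "msubst k g (Tail t) = Tail (msubst k g t)"
| "msubst k g (App t s) = App (msubst k g t) (msubst k g s)"
| "msubst k g (Case A t t0 t1 te) =
     Case A (msubst k g t) (msubst k g t0) (msubst k g t1) (msubst k g te)"
| "msubst k g (Rec A t t0 t1 te) =
     Rec A (msubst k g t) (msubst k g t0) (msubst k g t1) (msubst k g te)"
| "msubst k g Rand = Rand"

lemma subst_beyond_dom:
  "E \<turnstile> t : A \<Longrightarrow> dom E \<subseteq> {..<k} \<Longrightarrow> subst k v t = t"
proof (induction arbitrary: k rule: typing.induct)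
  case (T_Lam E a A t B)
  then have "dom (ext E a A) \<subseteq> {..<Suc k}"
    by (auto simp: ext_def dom_def subset_iff split: nat.splits)
  then show ?case
    using T_Lam.IH by simp
qed auto

lemma msubst_cong_typed:
  assumes "E \<turnstile> t : A" and "\<forall>i \<in> dom E. k \<le> i \<longrightarrow> g (i - k) = h (i - k)"
  shows "msubst k g t = msubst k h t"
  using assms
proof (induction arbitrary: k rule: typing.induct)
  case (T_Lam E a A t B)
  have "msubst (Suc k) g t = msubst (Suc k) h t"
  proof (intro T_Lam.IH ballI impI)
    fix i assume i: "i \<in> dom (ext E a A)" "Suc k \<le> i"
    then obtain j where "i = Suc j"
      by (cases i) auto
    then show "g (i - Suc k) = h (i - Suc k)"
      using T_Lam.prems i by (force simp: ext_def)
  qed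
  then show ?case by simp
qed (auto simp: ball_Un domI)

lemma msubst_beyond_dom:
  "E \<turnstile> t : A \<Longrightarrow> dom E \<subseteq> {..<k} \<Longrightarrow> msubst k g t = t"
proof (induction arbitrary: k rule: typing.induct)
  case (T_Lam E a A t B)
  then have "dom (ext E a A) \<subseteq> {..<Suc k}"
    by (auto simp: ext_def dom_def subset_iff split: nat.splits)
  then show ?case
    using T_Lam.IH by simp
qed auto

lemma subst_closed: "\<turnstile> t : A \<Longrightarrow> subst k v t = t"
  by (erule subst_beyond_dom) simp

lemma msubst_closed: "\<turnstile> t : A \<Longrightarrow> msubst k g t = t"
  by (erule msubst_beyond_dom) simp

text \<open>Only variables bound on the way down survive; for \<open>k = 0\<close> the result is
  closed. General \<open>k\<close> is what the induction needs under a binder.\<close>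

lemma typing_msubst:
  assumes "E \<turnstile> t : B" and "\<And>i a A. E i = Some (a, A) \<Longrightarrow> k \<le> i \<Longrightarrow> \<turnstile> g (i - k) : A"
  shows "E |` {..<k} \<turnstile> msubst k g t : B"
  using assms
proof (induction arbitrary: k rule: typing.induct)
  case (T_Var E i a A)
  show ?case
  proof (cases "i < k")
    case True
    then show ?thesis
      using T_Var.hyps by (auto intro!: typing.T_Var[of _ _ a])
  next
    case False
    then show ?thesis
      using T_Var.prems[OF T_Var.hyps] by (simp add: closed_typing_weaken)
  qed
next
  case (T_Lam E a A t B)
  have "ext E a A |` {..<Suc k} \<turnstile> msubst (Suc k) g t : B"
  proof (rule T_Lam.IH)
    fix i b C assume "ext E a A i = Some (b, C)" "Suc k \<le> i"
    then show "\<turnstile> g (i - Suc k) : C"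
      using T_Lam.prems[of "i - 1" b C] by (cases i) (auto simp: ext_def)
  qed
  then show ?case
    unfolding ext_restrict by (auto intro: typing.T_Lam)
next
  case (T_App G D1 D2 t a A B s)
  note le = disjoint_envs_map_le[OF T_App.hyps(2), unfolded map_le_iff, rule_format]
  show ?case
    unfolding restrict_map_add msubst.simps
  proof (rule typing.T_App)
    show "disjoint_envs [G |` {..<k}, D1 |` {..<k}, D2 |` {..<k}]"
      using disjoint_envs_restrict[OF T_App.hyps(2)] by simp
    show "G |` {..<k} ++ D1 |` {..<k} \<turnstile> msubst k g t : Arr a A B"
      unfolding restrict_map_add[symmetric] by (rule T_App.IH(1), erule T_App.prems[OF le(1)])
    show "G |` {..<k} ++ D2 |` {..<k} \<turnstile> msubst k g s : A"
      unfolding restrict_map_add[symmetric] by (rule T_App.IH(2), erule T_App.prems[OF le(2)])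
    show "env_below (G |` {..<k} ++ D2 |` {..<k}) a"
      unfolding restrict_map_add[symmetric] by (rule env_below_restrict) fact
  qed (simp add: str_only_restrict T_App.hyps)
next
  case (T_Case G D1 D2 D3 D4 t t0 A t1 te)
  note le = disjoint_envs_map_le_Case[OF T_Case.hyps(2), unfolded map_le_iff, rule_format]
  show ?case
    unfolding restrict_map_add msubst.simps
  proof (rule typing.T_Case)
    show "disjoint_envs [G |` {..<k}, D1 |` {..<k}, D2 |` {..<k}, D3 |` {..<k}, D4 |` {..<k}]"
      using disjoint_envs_restrict[OF T_Case.hyps(2)] by simp
    show "G |` {..<k} ++ D1 |` {..<k} \<turnstile> msubst k g t : Str"
      unfolding restrict_map_add[symmetric] by (rule T_Case.IH(1), erule T_Case.prems[OF le(1)])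
    show "G |` {..<k} ++ D2 |` {..<k} \<turnstile> msubst k g t0 : A"
      unfolding restrict_map_add[symmetric] by (rule T_Case.IH(2), erule T_Case.prems[OF le(2)])
    show "G |` {..<k} ++ D3 |` {..<k} \<turnstile> msubst k g t1 : A"
      unfolding restrict_map_add[symmetric] by (rule T_Case.IH(3), erule T_Case.prems[OF le(3)])
    show "G |` {..<k} ++ D4 |` {..<k} \<turnstile> msubst k g te : A"
      unfolding restrict_map_add[symmetric] by (rule T_Case.IH(4), erule T_Case.prems[OF le(4)])
  qed (simp add: str_only_restrict T_Case.hyps)
next
  case (T_Rec G1 G2 G3 D1 D2 t t0 A t1 te)
  note le = disjoint_envs_map_le_Rec[OF T_Rec.hyps(4), unfolded map_le_iff, rule_format]
  show ?case
    unfolding restrict_map_add msubst.simps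
  proof (rule typing.T_Rec)
    show "disjoint_envs [G1 |` {..<k}, G2 |` {..<k}, G3 |` {..<k}, D1 |` {..<k}, D2 |` {..<k}]"
      using disjoint_envs_restrict[OF T_Rec.hyps(4)] by simp
    show "G1 |` {..<k} ++ D1 |` {..<k} \<turnstile> msubst k g t : Str"
      unfolding restrict_map_add[symmetric] by (rule T_Rec.IH(1), erule T_Rec.prems[OF le(1)])
    show "G1 |` {..<k} ++ G2 |` {..<k} \<turnstile> msubst k g t0 : Arr White Str (Arr Black A A)"
      unfolding restrict_map_add[symmetric] by (rule T_Rec.IH(2), erule T_Rec.prems[OF le(2)])
    show "G1 |` {..<k} ++ G3 |` {..<k} \<turnstile> msubst k g t1 : Arr White Str (Arr Black A A)"
      unfolding restrict_map_add[symmetric] by (rule T_Rec.IH(3), erule T_Rec.prems[OF le(3)])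
    show "G1 |` {..<k} ++ G2 |` {..<k} ++ G3 |` {..<k} ++ D2 |` {..<k} \<turnstile> msubst k g te : A"
      unfolding restrict_map_add[symmetric] by (rule T_Rec.IH(4), erule T_Rec.prems[OF le(4)])
    show "env_below (G1 |` {..<k} ++ D1 |` {..<k}) White"
      unfolding restrict_map_add[symmetric] by (rule env_below_restrict) fact
  qed (simp_all add: str_only_restrict T_Rec.hyps)
next
  case (T_Sub E t A B)
  then show ?case
    by (intro typing.T_Sub[OF T_Sub.IH])
qed (auto intro: T_Const T_Push0 T_Push1 T_Tail T_Rand)

text \<open>Beta reduction becomes extension of the substitution: the terms \<open>g i\<close> are
  closed, so the later \<open>subst\<close> leaves them alone.\<close>

lemma subst_msubst:
  assumes "\<And>i. \<exists>A. \<turnstile> g i : A"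
  shows "subst k w (msubst (Suc k) g t) = msubst k (case_nat w g) t"
proof (induction t arbitrary: k)
  case (Var i)
  consider "i < k" | "i = k" | j where "i = Suc (k + j)"
    by (metis linorder_cases less_imp_Suc_add)
  then show ?case
  proof cases
    case 3
    then show ?thesis
      using assms[of j] subst_closed by auto
  qed auto
qed auto

section \<open>The fundamental lemma for open terms\<close>

lemma str_onlyD: "str_only G \<Longrightarrow> G i = Some (a, A) \<Longrightarrow> A = Str"
  by (drule ranI) (auto simp: str_only_def)

text \<open>Variable \<open>i\<close> is the one that varies, over the values drawn from \<open>D\<close> or from \<open>D'\<close>.\<close>

definition hot :: "env \<Rightarrow> (nat \<Rightarrow> tm) \<Rightarrow> nat \<Rightarrow> tm pmf \<Rightarrow> tm pmf \<Rightarrow> real \<Rightarrow> bool" where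
  "hot E g i D D' e \<longleftrightarrow> 0 \<le> e \<and> (\<forall>j. \<exists>A. \<turnstile> g j : A) \<and> (\<forall>u \<in> set_pmf D \<union> set_pmf D'. \<exists>A. \<turnstile> u : A) \<and>
     (\<forall>j a A. j \<noteq> i \<longrightarrow> E j = Some (a, A) \<longrightarrow> red_val A (g j)) \<and>
     (\<forall>a A. E i = Some (a, A) \<longrightarrow> (\<forall>u \<in> set_pmf D \<union> set_pmf D'. red_val A u) \<and> near A e D D')"

lemma hot_mono: "hot F g i D D' e \<Longrightarrow> E \<subseteq>\<^sub>m F \<Longrightarrow> hot E g i D D' e"
  unfolding hot_def map_le_iff by blast

lemma hot_red:
  "hot E g i D D' e \<Longrightarrow> u \<in> set_pmf D \<union> set_pmf D' \<Longrightarrow> E j = Some (a, A) \<Longrightarrow> red_val A ((g(i := u)) j)"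
  unfolding hot_def by auto

lemma hot_typed:
  "hot E g i D D' e \<Longrightarrow> u \<in> set_pmf D \<union> set_pmf D' \<Longrightarrow> \<exists>A. \<turnstile> (g(i := u)) j : A"
  unfolding hot_def by auto

lemma hot_nonneg: "hot E g i D D' e \<Longrightarrow> 0 \<le> e"
  by (simp add: hot_def)

text \<open>This settles variables in shared contexts: once the varying variable is a string, only
  reducibility of each instance remains to be checked.\<close>

lemma hot_Str:
  assumes "hot E g i D D' e" "E i = Some (a, Str)"
    and "\<And>u. u \<in> set_pmf D \<union> set_pmf D' \<Longrightarrow> red_tm B (h u)"
  shows "nonexp D D' e B h"
  using assms by (intro nonexp_Str_values) (auto simp: hot_def simp del: near.simps red_val.simps)

lemma msubst_fun_upd_other:
  "E \<turnstile> t : B \<Longrightarrow> i \<notin> dom E \<Longrightarrow> msubst 0 (g(i := u)) t = msubst 0 g t"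
  by (rule msubst_cong_typed) auto

lemma nonexp_not_dom:
  assumes "E \<turnstile> t : B" "i \<notin> dom E" "nonexp D D' e A (\<lambda>u. msubst 0 (g(i := u)) t)"
  shows "red_tm A (msubst 0 g t)"
  using assms(3) unfolding msubst_fun_upd_other[OF assms(1,2)] nonexp_const by simp

text \<open>A varying non-string variable lies outside the shared parts, so in a branching rule it
  reaches either the scrutinee (or function) or the remaining premises, never both. What does not
  vary is reducible by \<open>nonexp_not_dom\<close>.\<close>

lemma fundamental:
  assumes "E \<turnstile> t : B" and "hot E g i D D' e"
  shows "nonexp D D' e B (\<lambda>u. msubst 0 (g(i := u)) t)"
  using assms
proof (induction arbitrary: g i D D' e rule: typing.induct)
  case (T_Var E j a A)
  show ?case
  proof (cases "j = i")
    case True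
    then show ?thesis
      using T_Var nonexp_values[of D D' A e] by (simp add: hot_def)
  next
    case False
    then show ?thesis
      using T_Var by (auto simp: hot_def nonexp_const intro!: red_val_red_tm)
  qed
next
  case (T_Lam E a A t B)
  define T where "T u = msubst (Suc 0) (g(i := u)) t" for u
  have sub: "subst 0 w (T u) = msubst 0 (case_nat w (g(i := u))) t"
    if "u \<in> set_pmf D \<union> set_pmf D'" for u w
    unfolding T_def by (rule subst_msubst[OF hot_typed[OF T_Lam.prems that]])
  \<comment> \<open>First use of the induction hypothesis: \<open>u\<close> is fixed and the bound
    variable varies.\<close>
  have arg: "nonexp P P' d B (\<lambda>w. msubst 0 (case_nat w (g(i := u))) t)"
    if u: "u \<in> set_pmf D \<union> set_pmf D'" and P: "\<forall>w \<in> set_pmf P \<union> set_pmf P'. red_val A w"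
      and near: "near A d P P'" for u P P' d
  proof -
    have upd: "(case_nat Rand (g(i := u)))(0 := w) = case_nat w (g(i := u))" for w
      by (rule ext) (simp split: nat.split)
    \<comment> \<open>\<open>Rand\<close> is a closed placeholder at index 0, overwritten by the
      drawn value.\<close>
    have "hot (ext E a A) (case_nat Rand (g(i := u))) 0 P P' d"
      unfolding hot_def
    proof (intro conjI allI impI ballI)
      show "\<exists>A. \<turnstile> case_nat Rand (g(i := u)) j : A" for j
        using hot_typed[OF T_Lam.prems u] T_Rand by (cases j) auto
      show "\<exists>A. \<turnstile> w : A" if "w \<in> set_pmf P \<union> set_pmf P'" for w
        using P that red_val_typed by blast
      show "red_val C (case_nat Rand (g(i := u)) j)" if "j \<noteq> 0" "ext E a A j = Some (b, C)" for j b C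
        using that hot_red[OF T_Lam.prems u, of "j - 1" b C] by (cases j) (simp_all add: ext_def)
      show "near C d P P'" if "ext E a A 0 = Some (b, C)" for b C
        using that near by (simp add: ext_def)
      show "red_val C w" if "ext E a A 0 = Some (b, C)" "w \<in> set_pmf P \<union> set_pmf P'" for b C w
        using that P by (simp add: ext_def)
    qed (rule near_nonneg[OF near])
    from T_Lam.IH[OF this] show ?thesis
      unfolding upd .
  qed
  \<comment> \<open>Equal point distributions at distance 0 turn \<open>arg\<close> into plain
    reducibility.\<close>
  have body: "red_tm B (subst 0 w (T u))" if u: "u \<in> set_pmf D \<union> set_pmf D'" and w: "red_val A w" for u w
    using arg[OF u, of "return_pmf w" "return_pmf w" 0] w near_refl[of 0] sub[OF u]
    by (auto dest: nonexp_red)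
  have typed: "\<turnstile> Lam a A (T u) : Arr a A B" if u: "u \<in> set_pmf D \<union> set_pmf D'" for u
  proof -
    have "E |` {..<0} \<turnstile> msubst 0 (g(i := u)) (Lam a A t) : Arr a A B"
      using hot_red[OF T_Lam.prems u] red_val_typed
      by (intro typing_msubst[OF typing.T_Lam[OF T_Lam.hyps]]) (metis diff_zero)
    then show ?thesis
      by (simp add: T_def)
  qed
  have red: "red_val (Arr a A B) (Lam a A (T u))" if u: "u \<in> set_pmf D \<union> set_pmf D'" for u
    unfolding red_val.simps
  proof (intro conjI typed[OF u] exI)
    show "Lam a A (T u) = Lam a A (T u)" ..
    show "\<forall>w. red_val A w \<longrightarrow> (\<exists>D. subst 0 w (T u) \<Down> D \<and> (\<forall>x\<in>set_pmf D. red_val B x))"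
      using body[OF u] by (auto simp: red_tm_def)
    show "\<forall>e D D'. (\<forall>w\<in>set_pmf D \<union> set_pmf D'. red_val A w) \<longrightarrow> near A e D D' \<longrightarrow>
      near B e (bind_pmf D (\<lambda>w. pass_value w (Lam a A (T u)))) (bind_pmf D' (\<lambda>w. pass_value w (Lam a A (T u))))"
      using nonexp_near[OF arg[OF u]] by (simp add: sub[OF u])
  qed
  have "nonexp D D' e (Arr a A B) (\<lambda>u. Lam a A (T u))"
  proof (rule nonexpI)
    fix u assume u: "u \<in> set_pmf D \<union> set_pmf D'"
    show "red_tm (Arr a A B) (Lam a A (T u))"
      by (rule red_val_red_tm[OF red[OF u]])
    show "\<lbrakk>Lam a A (T u)\<rbrakk> = return_pmf (Lam a A (T u))"
      by (rule sem_value[OF red_val_is_value[OF red[OF u]]])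
  next
    \<comment> \<open>Second use: the bound variable is fixed to \<open>v\<close> and the outer
      variable, now at index \<open>Suc i\<close>, varies.\<close>
    have "near B e (bind_pmf D (\<lambda>u. \<lbrakk>subst 0 v (T u)\<rbrakk>)) (bind_pmf D' (\<lambda>u. \<lbrakk>subst 0 v (T u)\<rbrakk>))"
      if v: "red_val A v" for v
    proof -
      have upd: "(case_nat v g)(Suc i := u) = case_nat v (g(i := u))" for u
        by (rule ext) (simp split: nat.split)
      have "hot (ext E a A) (case_nat v g) (Suc i) D D' e"
        unfolding hot_def
      proof (intro conjI allI impI ballI)
        show "\<exists>A. \<turnstile> case_nat v g j : A" for j
          using T_Lam.prems red_val_typed[OF v] by (cases j) (auto simp: hot_def)
        show "\<exists>A. \<turnstile> w : A" if "w \<in> set_pmf D \<union> set_pmf D'" for w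
          using T_Lam.prems that by (simp add: hot_def)
        show "red_val C (case_nat v g j)" if "j \<noteq> Suc i" "ext E a A j = Some (b, C)" for j b C
          using that T_Lam.prems v by (cases j) (auto simp: hot_def ext_def)
        show "near C e D D'" if "ext E a A (Suc i) = Some (b, C)" for b C
          using that T_Lam.prems by (simp add: hot_def ext_def)
        show "red_val C w" if "ext E a A (Suc i) = Some (b, C)" "w \<in> set_pmf D \<union> set_pmf D'" for b C w
          using that T_Lam.prems by (simp add: hot_def ext_def)
      qed (rule hot_nonneg[OF T_Lam.prems])
      from T_Lam.IH[OF this]
      have "nonexp D D' e B (\<lambda>u. msubst 0 (case_nat v (g(i := u))) t)"
        unfolding upd .
      moreover have "bind_pmf D (\<lambda>u. \<lbrakk>subst 0 v (T u)\<rbrakk>) = bind_pmf D (\<lambda>u. \<lbrakk>msubst 0 (case_nat v (g(i := u))) t\<rbrakk>)"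
        "bind_pmf D' (\<lambda>u. \<lbrakk>subst 0 v (T u)\<rbrakk>) = bind_pmf D' (\<lambda>u. \<lbrakk>msubst 0 (case_nat v (g(i := u))) t\<rbrakk>)"
        by (auto intro!: bind_pmf_cong simp: sub)
      ultimately show ?thesis
        using nonexp_near by metis
    qed
    then show "near (Arr a A B) e (bind_pmf D (\<lambda>u. return_pmf (Lam a A (T u))))
      (bind_pmf D' (\<lambda>u. return_pmf (Lam a A (T u))))"
      using hot_nonneg[OF T_Lam.prems] by (simp add: bind_assoc_pmf bind_return_pmf)
  qed
  then show ?case
    by (simp only: T_def msubst.simps)
next
  case (T_App G D1 D2 t a A B s)
  let ?E = "G ++ D1 ++ D2"
  note le = disjoint_envs_map_le[OF T_App.hyps(2)]
  have t: "nonexp D D' e (Arr a A B) (\<lambda>u. msubst 0 (g(i := u)) t)"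
    by (rule T_App.IH(1)[OF hot_mono[OF T_App.prems le(1)]])
  have s: "nonexp D D' e A (\<lambda>u. msubst 0 (g(i := u)) s)"
    by (rule T_App.IH(2)[OF hot_mono[OF T_App.prems le(2)]])
  show ?case
  proof (cases "\<exists>b. ?E i = Some (b, Str)")
    \<comment> \<open>A string declared in \<open>G\<close> may vary in both premises at once, so
      the application is treated as a whole.\<close>
    case True
    then obtain b where b: "?E i = Some (b, Str)" ..
    show ?thesis
      unfolding msubst.simps by (rule hot_Str[OF T_App.prems b red_App(2)[OF t[THEN nonexp_red] s[THEN nonexp_red]]])
  next
    case False
    have "G i = None"
    proof (cases "G i")
      case (Some d)
      then have "?E i = Some (fst d, Str)"
        using disjoint_envs_nth_None[OF T_App.hyps(2), of i] str_onlyD[OF T_App.hyps(1), of i]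
        by (cases d) (auto simp: map_add_Some_iff)
      then have "\<exists>b. ?E i = Some (b, Str)" ..
      with False show ?thesis ..
    qed
    then consider "i \<notin> dom (G ++ D1)" | "i \<notin> dom (G ++ D2)"
      using disjoint_envs_nth_None[OF T_App.hyps(2), of i] by (auto simp: map_add_Some_iff)
    then show ?thesis
    proof cases
      case 1
      then show ?thesis
        using nonexp_AppR[OF nonexp_not_dom[OF T_App.hyps(3) 1 t] s]
        by (simp only: msubst.simps msubst_fun_upd_other[OF T_App.hyps(3) 1])
    next
      case 2
      then show ?thesis
        using nonexp_AppL[OF t nonexp_not_dom[OF T_App.hyps(4) 2 s]]
        by (simp only: msubst.simps msubst_fun_upd_other[OF T_App.hyps(4) 2])
    qed
  qed
next
  case (T_Sub E t A B)
  then show ?case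
    using nonexp_subty by blast
next
  case (T_Case G D1 D2 D3 D4 t t0 A t1 te)
  let ?E = "G ++ D1 ++ D2 ++ D3 ++ D4"
  note le = disjoint_envs_map_le_Case[OF T_Case.hyps(2)]
  note const = msubst_fun_upd_other
  have t: "nonexp D D' e Str (\<lambda>u. msubst 0 (g(i := u)) t)"
    by (rule T_Case.IH(1)[OF hot_mono[OF T_Case.prems le(1)]])
  have t0: "nonexp D D' e A (\<lambda>u. msubst 0 (g(i := u)) t0)"
    by (rule T_Case.IH(2)[OF hot_mono[OF T_Case.prems le(2)]])
  have t1: "nonexp D D' e A (\<lambda>u. msubst 0 (g(i := u)) t1)"
    by (rule T_Case.IH(3)[OF hot_mono[OF T_Case.prems le(3)]])
  have te: "nonexp D D' e A (\<lambda>u. msubst 0 (g(i := u)) te)"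
    by (rule T_Case.IH(4)[OF hot_mono[OF T_Case.prems le(4)]])
  show ?case
  proof (cases "\<exists>b. ?E i = Some (b, Str)")
    case True
    then obtain b where b: "?E i = Some (b, Str)" ..
    show ?thesis
      unfolding msubst.simps by (rule hot_Str[OF T_Case.prems b red_Case(2)[OF t[THEN nonexp_red] t0[THEN nonexp_red] t1[THEN nonexp_red] te[THEN nonexp_red]]])
  next
    case False
    have "G i = None"
    proof (cases "G i")
      case (Some d)
      then have "?E i = Some (fst d, Str)"
        using disjoint_envs_nth_None[OF T_Case.hyps(2), of i] str_onlyD[OF T_Case.hyps(1), of i]
        by (cases d) (auto simp: map_add_Some_iff)
      then have "\<exists>b. ?E i = Some (b, Str)" ..
      with False show ?thesis ..
    qed
    then consider "i \<notin> dom (G ++ D1)"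
      | "i \<notin> dom (G ++ D2)" "i \<notin> dom (G ++ D3)" "i \<notin> dom (G ++ D4)"
      using disjoint_envs_nth_None[OF T_Case.hyps(2), of i] by (auto simp: map_add_Some_iff)
    then show ?thesis
    proof cases
      case 1
      show ?thesis
        using nonexp_Case_branches[OF nonexp_not_dom[OF T_Case.hyps(3) 1 t] t0 t1 te]
        by (simp only: msubst.simps const[OF T_Case.hyps(3) 1])
    next
      case 2
      show ?thesis
        using nonexp_Case_scrutinee[OF t nonexp_not_dom[OF T_Case.hyps(4) 2(1) t0]
            nonexp_not_dom[OF T_Case.hyps(5) 2(2) t1] nonexp_not_dom[OF T_Case.hyps(6) 2(3) te]]
        by (simp only: msubst.simps const[OF T_Case.hyps(4) 2(1)] const[OF T_Case.hyps(5) 2(2)]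
            const[OF T_Case.hyps(6) 2(3)])
    qed
  qed
next
  case (T_Rec G1 G2 G3 D1 D2 t t0 A t1 te)
  let ?E = "G1 ++ G2 ++ G3 ++ D1 ++ D2"
  note le = disjoint_envs_map_le_Rec[OF T_Rec.hyps(4)]
  note const = msubst_fun_upd_other
  have t: "nonexp D D' e Str (\<lambda>u. msubst 0 (g(i := u)) t)"
    by (rule T_Rec.IH(1)[OF hot_mono[OF T_Rec.prems le(1)]])
  have t0: "nonexp D D' e (Arr White Str (Arr Black A A)) (\<lambda>u. msubst 0 (g(i := u)) t0)"
    by (rule T_Rec.IH(2)[OF hot_mono[OF T_Rec.prems le(2)]])
  have t1: "nonexp D D' e (Arr White Str (Arr Black A A)) (\<lambda>u. msubst 0 (g(i := u)) t1)"
    by (rule T_Rec.IH(3)[OF hot_mono[OF T_Rec.prems le(3)]])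
  have te: "nonexp D D' e A (\<lambda>u. msubst 0 (g(i := u)) te)"
    by (rule T_Rec.IH(4)[OF hot_mono[OF T_Rec.prems le(4)]])
  show ?case
  proof (cases "\<exists>b. ?E i = Some (b, Str)")
    case True
    then obtain b where b: "?E i = Some (b, Str)" ..
    show ?thesis
      unfolding msubst.simps by (rule hot_Str[OF T_Rec.prems b red_Rec(2)[OF t[THEN nonexp_red] t0[THEN nonexp_red] t1[THEN nonexp_red] te[THEN nonexp_red]]])
  next
    case False
    \<comment> \<open>The step functions are run repeatedly, but their contexts declare strings
      only, so a non-string variable cannot occur in them.\<close>
    have "G1 i = None \<and> G2 i = None \<and> G3 i = None"
    proof (rule ccontr)
      assume "\<not> ?thesis"
      then have "\<exists>b. ?E i = Some (b, Str)"
        using disjoint_envs_nth_None[OF T_Rec.hyps(4), of i] T_Rec.hyps(1-3)[THEN str_onlyD, of i]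
        by (auto simp: map_add_Some_iff)
      then show False
        using False by blast
    qed
    then have 0: "i \<notin> dom (G1 ++ G2)" "i \<notin> dom (G1 ++ G3)"
      and "i \<notin> dom (G1 ++ D1) \<or> i \<notin> dom (G1 ++ G2 ++ G3 ++ D2)"
      using disjoint_envs_nth_None[OF T_Rec.hyps(4), of i] by (auto simp: map_add_Some_iff)
    note br = nonexp_not_dom[OF T_Rec.hyps(6) 0(1) t0] nonexp_not_dom[OF T_Rec.hyps(7) 0(2) t1]
    note const_br = const[OF T_Rec.hyps(6) 0(1)] const[OF T_Rec.hyps(7) 0(2)]
    from \<open>i \<notin> dom (G1 ++ D1) \<or> i \<notin> dom (G1 ++ G2 ++ G3 ++ D2)\<close> show ?thesis
    proof
      assume 1: "i \<notin> dom (G1 ++ D1)"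
      show ?thesis
        using nonexp_Rec_base[OF nonexp_not_dom[OF T_Rec.hyps(5) 1 t] br te]
        by (simp only: msubst.simps const[OF T_Rec.hyps(5) 1] const_br)
    next
      assume 2: "i \<notin> dom (G1 ++ G2 ++ G3 ++ D2)"
      show ?thesis
        using nonexp_Rec_scrutinee[OF t br nonexp_not_dom[OF T_Rec.hyps(8) 2 te]]
        by (simp only: msubst.simps const[OF T_Rec.hyps(8) 2] const_br)
    qed
  qed
next
  case (T_Push0 E t)
  show ?case
    unfolding msubst.simps by (rule nonexp_Push0[OF T_Push0.IH[OF T_Push0.prems]])
next
  case (T_Push1 E t)
  show ?case
    unfolding msubst.simps by (rule nonexp_Push1[OF T_Push1.IH[OF T_Push1.prems]])
next
  case (T_Tail E t)
  show ?case
    unfolding msubst.simps by (rule nonexp_Tail[OF T_Tail.IH[OF T_Tail.prems]])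
qed (auto simp: nonexp_const hot_nonneg red_Const red_Rand)


lemma closed_red_tm:
  assumes "\<turnstile> t : A"
  shows "red_tm A t"
proof -
  \<comment> \<open>Nothing is declared, so the index and the distributions are arbitrary.\<close>
  have "hot Map.empty (\<lambda>_. Rand) 0 (return_pmf Rand) (return_pmf Rand) 0"
    by (auto simp: hot_def intro: T_Rand)
  from fundamental[OF assms this] show ?thesis
    by (simp add: msubst_closed[OF assms] nonexp_const)
qed

lemma typed_red_msubst:
  assumes "E \<turnstile> t : B" and "\<And>i a A. E i = Some (a, A) \<Longrightarrow> red_val A (g i)"
  shows "red_tm B (msubst 0 g t)"
proof (rule closed_red_tm)
  have "E |` {..<0} \<turnstile> msubst 0 g t : B"
    using assms(2) red_val_typed by (intro typing_msubst[OF assms(1)]) (metis diff_zero)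
  then show "\<turnstile> msubst 0 g t : B"
    by simp
qed

lemma near_of_traces:
  assumes "\<And>T. compatible A T \<Longrightarrow> \<bar>trace_prob D T - trace_prob D' T\<bar> \<le> e" "0 \<le> e"
  shows "near A e D D'"
  using assms(1)
proof (induction A arbitrary: D D')
  case Str
  have "\<bar>view M D - view M D'\<bar> \<le> e" if "finite M" for M
    using Str.prems[OF compatible.intros(1)[OF that]] by (simp add: view_def)
  then show ?case
    using assms(2) by simp
next
  case (Arr a A B)
  have "near B e (bind_pmf D (pass_value v)) (bind_pmf D' (pass_value v))" if v: "red_val A v" for v
  proof (rule Arr.IH(2))
    fix T assume "compatible B T"
    then have "compatible (Arr a A B) (Pass v # T)"
      by (rule compatible.intros(2)[OF red_val_is_value[OF v] red_val_typed[OF v]])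
    from Arr.prems[OF this]
    show "\<bar>trace_prob (bind_pmf D (pass_value v)) T - trace_prob (bind_pmf D' (pass_value v)) T\<bar> \<le> e"
      by simp
  qed
  then show ?case
    using assms(2) by simp
qed

section \<open>Contexts\<close>

text \<open>
  \<open>ctx_typing\<close> says nothing about derivations with a hole. The types of \<open>inhabitant A\<close> are exactly the
  supertypes of \<open>A\<close>, so a derivation for a context filled with it types the hole like a variable of type \<open>A\<close>.
\<close>

fun inhabitant :: "ty \<Rightarrow> tm" where
  "inhabitant Str = Const []"
| "inhabitant (Arr a A B) = Lam a A (inhabitant B)"

lemma typing_inhabitant: "E \<turnstile> inhabitant A : A"
  by (induction A arbitrary: E) (auto intro: T_Const T_Lam)

lemma is_value_inhabitant: "is_value (inhabitant A)"
  by (cases A) (auto intro: is_value.intros)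

text \<open>Inversion up to trailing subsumptions, here and for the constructors below.\<close>

lemma typing_Const_subty: "E \<turnstile> Const m : B \<Longrightarrow> subty Str B"
  by (induction E "Const m" B rule: typing.induct) (auto intro: subty.intros)

lemma typing_Lam_subty:
  "E \<turnstile> Lam a A t : B \<Longrightarrow> \<exists>C. (ext E a A \<turnstile> t : C) \<and> subty (Arr a A C) B"
  by (induction E "Lam a A t" B rule: typing.induct) (blast intro: subty.intros)+

lemma typing_Push0_subty: "E \<turnstile> Push0 t : B \<Longrightarrow> (E \<turnstile> t : Str) \<and> subty Str B"
  by (induction E "Push0 t" B rule: typing.induct) (blast intro: subty.intros)+

lemma typing_Push1_subty: "E \<turnstile> Push1 t : B \<Longrightarrow> (E \<turnstile> t : Str) \<and> subty Str B"
  by (induction E "Push1 t" B rule: typing.induct) (blast intro: subty.intros)+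

lemma typing_Tail_subty: "E \<turnstile> Tail t : B \<Longrightarrow> (E \<turnstile> t : Str) \<and> subty Str B"
  by (induction E "Tail t" B rule: typing.induct) (blast intro: subty.intros)+

lemma typing_App_subty:
  "E \<turnstile> App t s : B \<Longrightarrow> \<exists>G D1 D2 a A C. E = G ++ D1 ++ D2 \<and> str_only G \<and>
     disjoint_envs [G, D1, D2] \<and> (G ++ D1 \<turnstile> t : Arr a A C) \<and> (G ++ D2 \<turnstile> s : A) \<and>
     env_below (G ++ D2) a \<and> subty C B"
  by (induction E "App t s" B rule: typing.induct) (blast intro: subty.intros)+

lemma typing_Case_subty:
  "E \<turnstile> Case A t t0 t1 te : B \<Longrightarrow> \<exists>G D1 D2 D3 D4. E = G ++ D1 ++ D2 ++ D3 ++ D4 \<and> str_only G \<and>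
     disjoint_envs [G, D1, D2, D3, D4] \<and> (G ++ D1 \<turnstile> t : Str) \<and> (G ++ D2 \<turnstile> t0 : A) \<and>
     (G ++ D3 \<turnstile> t1 : A) \<and> (G ++ D4 \<turnstile> te : A) \<and> subty A B"
  by (induction E "Case A t t0 t1 te" B rule: typing.induct) (blast intro: subty.intros)+

lemma typing_Rec_subty:
  "E \<turnstile> Rec A t t0 t1 te : B \<Longrightarrow> \<exists>G1 G2 G3 D1 D2. E = G1 ++ G2 ++ G3 ++ D1 ++ D2 \<and>
     str_only G1 \<and> str_only G2 \<and> str_only G3 \<and> disjoint_envs [G1, G2, G3, D1, D2] \<and>
     (G1 ++ D1 \<turnstile> t : Str) \<and> (G1 ++ G2 \<turnstile> t0 : Arr White Str (Arr Black A A)) \<and>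
     (G1 ++ G3 \<turnstile> t1 : Arr White Str (Arr Black A A)) \<and> (G1 ++ G2 ++ G3 ++ D2 \<turnstile> te : A) \<and>
     env_below (G1 ++ D1) White \<and> white_free A \<and> subty A B"
  by (induction E "Rec A t t0 t1 te" B rule: typing.induct) (blast intro: subty.intros)+

text \<open>The annotation of \<open>Lam\<close> pins the aspect and argument type, so apart from
  subsumption only the result type could vary, and the induction covers it.\<close>

lemma inhabitant_subty: "E \<turnstile> inhabitant A : B \<Longrightarrow> subty A B"
proof (induction A arbitrary: E B)
  case Str
  then show ?case
    using typing_Const_subty by simp
next
  case (Arr a A B E B')
  then obtain C where "ext E a A \<turnstile> inhabitant B : C" and sub: "subty (Arr a A C) B'"
    using typing_Lam_subty by fastforce
  then have "subty (Arr a A B) (Arr a A C)"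
    using Arr.IH(2) by (cases a) (auto intro!: subty_arr subty_refl asp_le.intros)
  then show ?case
    using sub by (rule subty_trans)
qed

text \<open>Needed when the hole lies under a binder: the filled body is open there, beyond what
  \<open>ctx_typing\<close> speaks about.\<close>

lemma typing_fill:
  assumes "\<turnstile> u : A"
  shows "E \<turnstile> fill C (inhabitant A) : B \<Longrightarrow> E \<turnstile> fill C u : B"
proof (induction C arbitrary: E B)
  case Hole
  then show ?case
    using T_Sub[OF closed_typing_weaken[OF assms] inhabitant_subty] by simp
next
  case (C_Lam a A' C)
  then obtain B' where "ext E a A' \<turnstile> fill C (inhabitant A) : B'" "subty (Arr a A' B') B"
    using typing_Lam_subty by fastforce
  then show ?case
    using T_Sub[OF T_Lam[OF C_Lam.IH]] by simp
next
  case (C_AppL C r)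
  from typing_App_subty[OF C_AppL.prems[unfolded fill.simps]]
  obtain G D1 D2 a A' B' where E: "E = G ++ D1 ++ D2" and G: "str_only G" "disjoint_envs [G, D1, D2]"
    and t: "G ++ D1 \<turnstile> fill C (inhabitant A) : Arr a A' B'" and r: "G ++ D2 \<turnstile> r : A'"
    and below: "env_below (G ++ D2) a" and sub: "subty B' B"
    by blast
  show ?case
    unfolding E fill.simps by (rule T_Sub[OF T_App[OF G C_AppL.IH[OF t] r below] sub])
next
  case (C_AppR r C)
  from typing_App_subty[OF C_AppR.prems[unfolded fill.simps]]
  obtain G D1 D2 a A' B' where E: "E = G ++ D1 ++ D2" and G: "str_only G" "disjoint_envs [G, D1, D2]"
    and r: "G ++ D1 \<turnstile> r : Arr a A' B'" and t: "G ++ D2 \<turnstile> fill C (inhabitant A) : A'"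
    and below: "env_below (G ++ D2) a" and sub: "subty B' B"
    by blast
  show ?case
    unfolding E fill.simps by (rule T_Sub[OF T_App[OF G r C_AppR.IH[OF t] below] sub])
next
  case (C_Push0 C)
  then show ?case
    using typing_Push0_subty T_Sub[OF T_Push0] by fastforce
next
  case (C_Push1 C)
  then show ?case
    using typing_Push1_subty T_Sub[OF T_Push1] by fastforce
next
  case (C_Tail C)
  then show ?case
    using typing_Tail_subty T_Sub[OF T_Tail] by fastforce
next
  case (C_Case1 A' C t0 t1 te)
  from typing_Case_subty[OF C_Case1.prems[unfolded fill.simps]]
  obtain G D1 D2 D3 D4 where E: "E = G ++ D1 ++ D2 ++ D3 ++ D4"
    and G: "str_only G" "disjoint_envs [G, D1, D2, D3, D4]"
    and t: "G ++ D1 \<turnstile> fill C (inhabitant A) : Str"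
    and br: "G ++ D2 \<turnstile> t0 : A'" "G ++ D3 \<turnstile> t1 : A'" "G ++ D4 \<turnstile> te : A'" and sub: "subty A' B"
    by blast
  show ?case
    unfolding E fill.simps by (rule T_Sub[OF T_Case[OF G C_Case1.IH[OF t] br] sub])
next
  case (C_Case2 A' t C0 C1 Ce)
  from typing_Case_subty[OF C_Case2.prems[unfolded fill.simps]]
  obtain G D1 D2 D3 D4 where E: "E = G ++ D1 ++ D2 ++ D3 ++ D4"
    and G: "str_only G" "disjoint_envs [G, D1, D2, D3, D4]" and t: "G ++ D1 \<turnstile> t : Str"
    and br: "G ++ D2 \<turnstile> fill C0 (inhabitant A) : A'" "G ++ D3 \<turnstile> fill C1 (inhabitant A) : A'"
      "G ++ D4 \<turnstile> fill Ce (inhabitant A) : A'" and sub: "subty A' B"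
    by blast
  show ?case
    unfolding E fill.simps
    by (rule T_Sub[OF T_Case[OF G t C_Case2.IH(1)[OF br(1)] C_Case2.IH(2)[OF br(2)] C_Case2.IH(3)[OF br(3)]] sub])
next
  case (C_Rec A' C t0 t1 te)
  from typing_Rec_subty[OF C_Rec.prems[unfolded fill.simps]]
  obtain G1 G2 G3 D1 D2 where E: "E = G1 ++ G2 ++ G3 ++ D1 ++ D2"
    and G: "str_only G1" "str_only G2" "str_only G3" "disjoint_envs [G1, G2, G3, D1, D2]"
    and t: "G1 ++ D1 \<turnstile> fill C (inhabitant A) : Str"
    and br: "G1 ++ G2 \<turnstile> t0 : Arr White Str (Arr Black A' A')"
      "G1 ++ G3 \<turnstile> t1 : Arr White Str (Arr Black A' A')" "G1 ++ G2 ++ G3 ++ D2 \<turnstile> te : A'"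
    and side: "env_below (G1 ++ D1) White" "white_free A'" and sub: "subty A' B"
    by blast
  show ?case
    unfolding E fill.simps by (rule T_Sub[OF T_Rec[OF G C_Rec.IH[OF t] br side] sub])
qed auto

section \<open>Contexts do not increase the distance\<close>

text \<open>The analogue of \<open>hot\<close> with no varying variable. Undeclared indices also get
  closed terms, as \<open>subst_msubst\<close> requires.\<close>

definition red_env :: "env \<Rightarrow> (nat \<Rightarrow> tm) \<Rightarrow> bool" where
  "red_env E g \<longleftrightarrow> (\<forall>j. \<exists>A. \<turnstile> g j : A) \<and> (\<forall>j a A. E j = Some (a, A) \<longrightarrow> red_val A (g j))"

lemma red_env_mono: "red_env F g \<Longrightarrow> E \<subseteq>\<^sub>m F \<Longrightarrow> red_env E g"
  unfolding red_env_def map_le_iff by blast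

lemma red_env_msubst: "red_env E g \<Longrightarrow> E \<turnstile> t : B \<Longrightarrow> red_tm B (msubst 0 g t)"
  by (rule typed_red_msubst) (auto simp: red_env_def)

lemma red_env_ext:
  assumes "red_env E g" "red_val A v"
  shows "red_env (ext E a A) (case_nat v g)"
  unfolding red_env_def
proof (intro conjI allI impI)
  show "\<exists>A. \<turnstile> case_nat v g j : A" for j
    using assms red_val_typed by (cases j) (auto simp: red_env_def)
  show "red_val C (case_nat v g j)" if "ext E a A j = Some (b, C)" for j b C
    using that assms by (cases j) (auto simp: red_env_def ext_def)
qed

text \<open>The index is now the term in the hole, with point distributions at \<open>t\<close> and
  \<open>s\<close>. Binders above the hole force an open context under a substitution, which leaves
  the closed hole content unchanged; terms beside the hole are reducible by the fundamental
  lemma.\<close>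

lemma nonexp_fill:
  assumes t: "\<turnstile> t : A" and s: "\<turnstile> s : A" and near: "near A e \<lbrakk>t\<rbrakk> \<lbrakk>s\<rbrakk>"
  shows "E \<turnstile> fill C (inhabitant A) : B \<Longrightarrow> red_env E g \<Longrightarrow>
    nonexp (return_pmf t) (return_pmf s) e B (\<lambda>u. msubst 0 g (fill C u))"
proof (induction C arbitrary: E B g)
  case (C_Tm r)
  then show ?case
    by (simp add: nonexp_const near_nonneg[OF near] red_env_msubst)
next
  case Hole
  have "nonexp (return_pmf t) (return_pmf s) e A (\<lambda>u. msubst 0 g u)"
    using closed_red_tm[OF t] closed_red_tm[OF s] near
    by (simp add: nonexp_def bind_return_pmf msubst_closed[OF t] msubst_closed[OF s])
  then show ?case
    using nonexp_subty[OF inhabitant_subty[OF Hole.prems(1)[unfolded fill.simps]]] by simp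
next
  case (C_Lam a A' C)
  obtain B' where C: "ext E a A' \<turnstile> fill C (inhabitant A) : B'" and sub: "subty (Arr a A' B') B"
    using typing_Lam_subty C_Lam.prems(1) by fastforce
  define T where "T u = Lam a A' (msubst (Suc 0) g (fill C u))" for u
  have red: "red_tm (Arr a A' B') (T u)" if "\<turnstile> u : A" for u
    using red_env_msubst[OF C_Lam.prems(2) T_Lam[OF typing_fill[OF that C]]] by (simp add: T_def)
  \<comment> \<open>Two abstractions are compared by the values passed to them; each such value
    extends the substitution for the body.\<close>
  have "near B' e (pass_value v (T t)) (pass_value v (T s))" if "red_val A' v" for v
  proof -
    have "subst 0 v (msubst (Suc 0) g (fill C u)) = msubst 0 (case_nat v g) (fill C u)" for u
      using C_Lam.prems(2) by (intro subst_msubst) (simp add: red_env_def)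
    then show ?thesis
      using nonexp_near[OF C_Lam.IH[OF C red_env_ext[OF C_Lam.prems(2) that]]]
      by (simp add: T_def bind_return_pmf)
  qed
  then have "near (Arr a A' B') e (return_pmf (T t)) (return_pmf (T s))"
    using near_nonneg[OF near] by (simp add: bind_return_pmf)
  then have "nonexp (return_pmf t) (return_pmf s) e (Arr a A' B') T"
    using red[OF t] red[OF s]
    by (simp add: nonexp_def bind_return_pmf sem_value[of "T _", unfolded T_def, OF is_value.intros(2)] T_def
        del: near.simps)
  then have "nonexp (return_pmf t) (return_pmf s) e B T"
    by (rule nonexp_subty[OF sub])
  then show ?case
    by (simp add: T_def[abs_def])
next
  case (C_AppL C r)
  from typing_App_subty[OF C_AppL.prems(1)[unfolded fill.simps]]
  obtain G D1 D2 a A' B' where E: "E = G ++ D1 ++ D2" and G: "str_only G" "disjoint_envs [G, D1, D2]"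
    and C: "G ++ D1 \<turnstile> fill C (inhabitant A) : Arr a A' B'" and r: "G ++ D2 \<turnstile> r : A'"
    and sub: "subty B' B"
    by blast
  note env = red_env_mono[OF C_AppL.prems(2)[unfolded E]] and le = disjoint_envs_map_le[OF G(2)]
  show ?case
    unfolding fill.simps msubst.simps
    by (rule nonexp_subty[OF sub nonexp_AppL[OF C_AppL.IH[OF C env[OF le(1)]] red_env_msubst[OF env[OF le(2)] r]]])
next
  case (C_AppR r C)
  from typing_App_subty[OF C_AppR.prems(1)[unfolded fill.simps]]
  obtain G D1 D2 a A' B' where E: "E = G ++ D1 ++ D2" and G: "str_only G" "disjoint_envs [G, D1, D2]"
    and r: "G ++ D1 \<turnstile> r : Arr a A' B'" and C: "G ++ D2 \<turnstile> fill C (inhabitant A) : A'"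
    and sub: "subty B' B"
    by blast
  note env = red_env_mono[OF C_AppR.prems(2)[unfolded E]] and le = disjoint_envs_map_le[OF G(2)]
  show ?case
    unfolding fill.simps msubst.simps
    by (rule nonexp_subty[OF sub nonexp_AppR[OF red_env_msubst[OF env[OF le(1)] r] C_AppR.IH[OF C env[OF le(2)]]]])
next
  case (C_Push0 C)
  note C = typing_Push0_subty[OF C_Push0.prems(1)[unfolded fill.simps]]
  show ?case
    unfolding fill.simps msubst.simps
    by (rule nonexp_subty[OF conjunct2[OF C] nonexp_Push0[OF C_Push0.IH[OF conjunct1[OF C] C_Push0.prems(2)]]])
next
  case (C_Push1 C)
  note C = typing_Push1_subty[OF C_Push1.prems(1)[unfolded fill.simps]]
  show ?case
    unfolding fill.simps msubst.simps
    by (rule nonexp_subty[OF conjunct2[OF C] nonexp_Push1[OF C_Push1.IH[OF conjunct1[OF C] C_Push1.prems(2)]]])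
next
  case (C_Tail C)
  note C = typing_Tail_subty[OF C_Tail.prems(1)[unfolded fill.simps]]
  show ?case
    unfolding fill.simps msubst.simps
    by (rule nonexp_subty[OF conjunct2[OF C] nonexp_Tail[OF C_Tail.IH[OF conjunct1[OF C] C_Tail.prems(2)]]])
next
  case (C_Case1 A' C t0 t1 te)
  from typing_Case_subty[OF C_Case1.prems(1)[unfolded fill.simps]]
  obtain G D1 D2 D3 D4 where E: "E = G ++ D1 ++ D2 ++ D3 ++ D4"
    and G: "disjoint_envs [G, D1, D2, D3, D4]"
    and C: "G ++ D1 \<turnstile> fill C (inhabitant A) : Str"
    and br: "G ++ D2 \<turnstile> t0 : A'" "G ++ D3 \<turnstile> t1 : A'" "G ++ D4 \<turnstile> te : A'" and sub: "subty A' B"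
    by blast
  note env = disjoint_envs_map_le_Case[OF G, THEN red_env_mono[OF C_Case1.prems(2)[unfolded E]]]
  show ?case
    unfolding fill.simps msubst.simps
    by (rule nonexp_subty[OF sub nonexp_Case_scrutinee[OF C_Case1.IH[OF C env(1)]
          red_env_msubst[OF env(2) br(1)] red_env_msubst[OF env(3) br(2)] red_env_msubst[OF env(4) br(3)]]])
next
  case (C_Case2 A' r C0 C1 Ce)
  from typing_Case_subty[OF C_Case2.prems(1)[unfolded fill.simps]]
  obtain G D1 D2 D3 D4 where E: "E = G ++ D1 ++ D2 ++ D3 ++ D4"
    and G: "disjoint_envs [G, D1, D2, D3, D4]" and r: "G ++ D1 \<turnstile> r : Str"
    and br: "G ++ D2 \<turnstile> fill C0 (inhabitant A) : A'" "G ++ D3 \<turnstile> fill C1 (inhabitant A) : A'"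
      "G ++ D4 \<turnstile> fill Ce (inhabitant A) : A'" and sub: "subty A' B"
    by blast
  note env = disjoint_envs_map_le_Case[OF G, THEN red_env_mono[OF C_Case2.prems(2)[unfolded E]]]
  show ?case
    unfolding fill.simps msubst.simps
    by (rule nonexp_subty[OF sub nonexp_Case_branches[OF red_env_msubst[OF env(1) r]
          C_Case2.IH(1)[OF br(1) env(2)] C_Case2.IH(2)[OF br(2) env(3)] C_Case2.IH(3)[OF br(3) env(4)]]])
next
  case (C_Rec A' C t0 t1 te)
  from typing_Rec_subty[OF C_Rec.prems(1)[unfolded fill.simps]]
  obtain G1 G2 G3 D1 D2 where E: "E = G1 ++ G2 ++ G3 ++ D1 ++ D2"
    and G: "disjoint_envs [G1, G2, G3, D1, D2]"
    and C: "G1 ++ D1 \<turnstile> fill C (inhabitant A) : Str"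
    and br: "G1 ++ G2 \<turnstile> t0 : Arr White Str (Arr Black A' A')"
      "G1 ++ G3 \<turnstile> t1 : Arr White Str (Arr Black A' A')" "G1 ++ G2 ++ G3 ++ D2 \<turnstile> te : A'"
    and sub: "subty A' B"
    by blast
  note env = disjoint_envs_map_le_Rec[OF G, THEN red_env_mono[OF C_Rec.prems(2)[unfolded E]]]
  show ?case
    unfolding fill.simps msubst.simps
    by (rule nonexp_subty[OF sub nonexp_Rec_scrutinee[OF C_Rec.IH[OF C env(1)]
          red_env_msubst[OF env(2) br(1)] red_env_msubst[OF env(3) br(2)] red_env_msubst[OF env(4) br(3)]]])
qed

lemma ctx_diff_le:
  assumes t: "\<turnstile> t : A" and s: "\<turnstile> s : A" and near: "near A e \<lbrakk>t\<rbrakk> \<lbrakk>s\<rbrakk>" and C: "ctx_typing C A Str"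
  shows "\<bar>pmf \<lbrakk>fill C t\<rbrakk> (Const []) - pmf \<lbrakk>fill C s\<rbrakk> (Const [])\<bar> \<le> e"
proof -
  have "\<turnstile> fill C (inhabitant A) : Str"
    using C typing_inhabitant by (simp add: ctx_typing_def)
  moreover have "red_env Map.empty (\<lambda>_. Rand)"
    by (auto simp: red_env_def intro: T_Rand)
  ultimately have "nonexp (return_pmf t) (return_pmf s) e Str (\<lambda>u. msubst 0 (\<lambda>_. Rand) (fill C u))"
    by (rule nonexp_fill[OF t s near])
  moreover have "msubst 0 (\<lambda>_. Rand) (fill C u) = fill C u" if "\<turnstile> u : A" for u
    using C that msubst_closed unfolding ctx_typing_def by blast
  ultimately have "near Str e \<lbrakk>fill C t\<rbrakk> \<lbrakk>fill C s\<rbrakk>"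
    using t s nonexp_near by (fastforce simp: bind_return_pmf simp del: near.simps)
  then show ?thesis
    \<comment> \<open>Observing the empty string is the view of the singleton
      \<open>{[]}\<close>.\<close>
    unfolding near.simps view_def by (elim conjE allE[of _ "{[]}"]) simp
qed

section \<open>Traces as contexts\<close>

text \<open>Acceptance is signalled by the empty string, the outcome that the context distance
  reads. Each case distinction replaces \<open>M\<close> by its derivative under the bit read; when
  \<open>n\<close> exceeds all lengths, nothing is left to accept at depth 0.\<close>

fun tester :: "nat \<Rightarrow> bitstring set \<Rightarrow> tm \<Rightarrow> tm" where
  "tester 0 M t = Const [False]"
| "tester (Suc n) M t =
     Case Str t (tester n {w. False # w \<in> M} (Tail t)) (tester n {w. True # w \<in> M} (Tail t))
       (Const (if [] \<in> M then [] else [False]))"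

lemma subst_tester: "subst k v (tester n M t) = tester n M (subst k v t)"
  by (induction n arbitrary: M t) auto

text \<open>The copies of \<open>t\<close> are typable because all of \<open>E\<close> serves as the
  shared part, with empty unshared parts.\<close>

lemma typing_tester: "E \<turnstile> t : Str \<Longrightarrow> str_only E \<Longrightarrow> E \<turnstile> tester n M t : Str"
proof (induction n arbitrary: M t)
  case (Suc n)
  have "E \<turnstile> Case Str t t0 t1 te : Str" if "E \<turnstile> t0 : Str" "E \<turnstile> t1 : Str" "E \<turnstile> te : Str" for t0 t1 te
    using T_Case[of E Map.empty Map.empty Map.empty Map.empty t t0 Str t1 te] Suc.prems that
    by (simp add: disjoint_envs_def)
  then show ?case
    unfolding tester.simps using Suc T_Tail T_Const by blast
qed (auto intro: T_Const)

lemma sem_tester: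
  assumes "red_tm Str t" "\<lbrakk>t\<rbrakk> = return_pmf (Const m)" "\<forall>w \<in> M. length w < n"
  shows "red_tm Str (tester n M t) \<and> \<lbrakk>tester n M t\<rbrakk> = return_pmf (Const (if m \<in> M then [] else [False]))"
  using assms
proof (induction n arbitrary: M t m)
  case 0
  then show ?case
    by (auto simp: red_Const sem_value is_value.intros)
next
  case (Suc n)
  have "\<lbrakk>Tail t\<rbrakk> = return_pmf (Const (tl m))"
    by (simp add: red_Tail(1)[OF Suc.prems(1)] Suc.prems(2) bind_return_pmf)
  note IH = Suc.IH[OF red_Tail(2)[OF Suc.prems(1)] this]
  have 0: "\<forall>w \<in> {w. False # w \<in> M}. length w < n" and 1: "\<forall>w \<in> {w. True # w \<in> M}. length w < n"
    using Suc.prems(3) by fastforce+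
  note case_red = red_Case[OF Suc.prems(1) conjunct1[OF IH[OF 0]] conjunct1[OF IH[OF 1]] red_Const]
  show ?case
    using conjunct2[OF IH[OF 0]] conjunct2[OF IH[OF 1]]
    by (cases m) (auto simp: case_red Suc.prems(2) bind_return_pmf sem_value is_value.intros)
qed

text \<open>The tester copies its string, so it is put under a binder: call-by-value then samples
  the hole's string once and the hole is not duplicated. \<open>Suc\<close> of the total length is a
  crude strict bound on the lengths in \<open>M\<close>.\<close>

fun trace_ctx :: "ctx \<Rightarrow> trace \<Rightarrow> ctx" where
  "trace_ctx C (Pass v # T) = trace_ctx (C_AppL C v) T"
| "trace_ctx C (View M # T) = C_AppR (Lam Black Str (tester (Suc (\<Sum>w\<in>M. length w)) M (Var 0))) C"
| "trace_ctx C [] = C"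

lemma holes_trace_ctx: "holes (trace_ctx C T) = holes C"
  by (induction C T rule: trace_ctx.induct) auto

lemma typing_closed_App: "\<turnstile> t : Arr a A B \<Longrightarrow> \<turnstile> s : A \<Longrightarrow> \<turnstile> App t s : B"
  using T_App[of Map.empty Map.empty Map.empty t a A B s]
  by (simp add: str_only_def disjoint_envs_def env_below_def)

lemma typing_view_test: "\<turnstile> Lam a Str (tester n M (Var 0)) : Arr a Str Str"
  by (intro T_Lam typing_tester T_Var[of _ _ a]) (auto simp: ext_def str_only_def ran_def gr0_conv_Suc split: nat.splits)

text \<open>On a given string the tester is deterministic, so acceptance has the expectation of the
  indicator of \<open>M\<close>.\<close>

lemma pmf_view_test:
  assumes M: "finite M" and t: "\<turnstile> t : Str"
  shows "pmf \<lbrakk>App (Lam a Str (tester (Suc (\<Sum>w\<in>M. length w)) M (Var 0))) t\<rbrakk> (Const []) = view M \<lbrakk>t\<rbrakk>"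
proof -
  define n where "n = Suc (\<Sum>w\<in>M. length w)"
  have len: "\<forall>w \<in> M. length w < n"
    using member_le_sum[OF _ _ M, of _ length] by (auto simp: n_def less_Suc_eq_le)
  have sem: "\<lbrakk>tester n M (Const m)\<rbrakk> = return_pmf (Const (if m \<in> M then [] else [False]))" for m
    by (rule conjunct2[OF sem_tester[OF red_Const sem_value[OF is_value.intros(1)] len]])
  have "pmf \<lbrakk>App (Lam a Str (tester n M (Var 0))) t\<rbrakk> (Const [])
      = measure_pmf.expectation \<lbrakk>t\<rbrakk> (\<lambda>w. pmf \<lbrakk>tester n M w\<rbrakk> (Const []))"
    using red_App(1)[OF closed_red_tm[OF typing_view_test] closed_red_tm[OF t]]
    by (simp add: sem_value is_value.intros bind_return_pmf subst_tester pmf_bind)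
  also have "\<dots> = measure_pmf.expectation \<lbrakk>t\<rbrakk> (indicat_real (Const ` M))"
  proof (rule integral_cong_AE)
    show "AE w in measure_pmf \<lbrakk>t\<rbrakk>. pmf \<lbrakk>tester n M w\<rbrakk> (Const []) = indicat_real (Const ` M) w"
      unfolding AE_measure_pmf_iff
    proof
      fix w assume "w \<in> set_pmf \<lbrakk>t\<rbrakk>"
      then obtain m where "w = Const m"
        using red_tm_sem[OF closed_red_tm[OF t]] by auto
      then show "pmf \<lbrakk>tester n M w\<rbrakk> (Const []) = indicat_real (Const ` M) w"
        by (auto simp: sem indicator_def)
    qed
  qed auto
  also have "\<dots> = view M \<lbrakk>t\<rbrakk>"
    by (simp add: view_eq_prob[OF M])
  finally show ?thesis
    by (simp add: n_def)
qed

text \<open>\<open>C\<close> is the accumulator: it has already applied the hole to the values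
  passed so far, and \<open>A\<close> is the type that remains.\<close>

lemma trace_ctx_correct:
  assumes "compatible A T" "\<turnstile> fill C u : A"
  shows "(\<turnstile> fill (trace_ctx C T) u : Str) \<and>
    pmf \<lbrakk>fill (trace_ctx C T) u\<rbrakk> (Const []) = trace_prob \<lbrakk>fill C u\<rbrakk> T"
  using assms
proof (induction arbitrary: C rule: compatible.induct)
  case (1 M)
  then show ?case
    using pmf_view_test[OF 1] typing_closed_App[OF typing_view_test 1(2)] by (simp add: view_def del: tester.simps)
next
  case (2 v B A S b)
  have "\<turnstile> fill (C_AppL C v) u : A"
    using typing_closed_App 2 by simp
  moreover have "\<lbrakk>App (fill C u) v\<rbrakk> = bind_pmf \<lbrakk>fill C u\<rbrakk> (pass_value v)"
    using red_App(1)[OF closed_red_tm[OF 2(5)] closed_red_tm[OF 2(2)]] sem_value[OF 2(1)]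
    by (simp add: bind_return_pmf)
  ultimately show ?case
    using 2(4)[of "C_AppL C v"] by simp
qed

section \<open>Equality of the two suprema\<close>

text \<open>Real suprema are meaningful only over nonempty bounded sets; this supplies nonemptiness,
  passing \<open>inhabitant\<close> values.\<close>

lemma ex_compatible: "\<exists>T. compatible A T"
proof (induction A)
  case Str
  then show ?case
    using compatible.intros(1)[of "{}"] by blast
next
  case (Arr a A B)
  then show ?case
    using compatible.intros(2)[OF is_value_inhabitant typing_inhabitant] by blast
qed

theorem mainTheorem9:
  fixes A :: ty and t s :: tm
  assumes "\<turnstile> t : A" and "\<turnstile> s : A"
  shows "trace_dist A t s = ctx_dist A t s"
proof -
  define f where "f C = \<bar>pmf \<lbrakk>fill C t\<rbrakk> (Const []) - pmf \<lbrakk>fill C s\<rbrakk> (Const [])\<bar>" for C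
  define g where "g T = \<bar>Pr t T - Pr s T\<bar>" for T
  define Cs where "Cs = {C. holes C \<le> 1 \<and> ctx_typing C A Str}"
  have f_le: "f C \<le> 1" for C
    using pmf_le_1[of "\<lbrakk>fill C t\<rbrakk>" "Const []"] pmf_le_1[of "\<lbrakk>fill C s\<rbrakk>" "Const []"]
      pmf_nonneg[of "\<lbrakk>fill C t\<rbrakk>" "Const []"] pmf_nonneg[of "\<lbrakk>fill C s\<rbrakk>" "Const []"]
    unfolding f_def abs_le_iff by linarith
  have Cs: "trace_ctx Hole T \<in> Cs" if "compatible A T" for T
    using trace_ctx_correct[OF that, of Hole] by (auto simp: Cs_def ctx_typing_def holes_trace_ctx)
  have fg: "f (trace_ctx Hole T) = g T" if "compatible A T" for T
    using trace_ctx_correct[OF that, of Hole] assms by (simp add: f_def g_def Pr_def)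
  \<comment> \<open>Differences of probabilities are at most 1, and \<open>fg\<close> transfers the
    bound from contexts to traces.\<close>
  have bdd_f: "bdd_above (f ` Cs)" and bdd_g: "bdd_above (g ` {T. compatible A T})"
    using f_le fg by (auto intro!: bdd_aboveI2[where M = 1]) (metis f_le fg)
  obtain T0 where T0: "compatible A T0"
    using ex_compatible by blast
  have "(SUP T \<in> {T. compatible A T}. g T) = (SUP C \<in> Cs. f C)"
  proof (rule antisym)
    show "(SUP T \<in> {T. compatible A T}. g T) \<le> (SUP C \<in> Cs. f C)"
    proof (rule cSUP_least)
      show "g T \<le> (SUP C \<in> Cs. f C)" if "T \<in> {T. compatible A T}" for T
        using cSUP_upper[OF Cs bdd_f, of T] fg[of T] that by simp
    qed (use T0 in auto)
    have g_le: "g T \<le> (SUP T \<in> {T. compatible A T}. g T)" if "compatible A T" for T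
      using that by (intro cSUP_upper bdd_g) simp
    have "0 \<le> (SUP T \<in> {T. compatible A T}. g T)"
      by (rule order_trans[OF _ g_le[OF T0]]) (simp add: g_def)
    \<comment> \<open>The trace distance itself is taken as the bound \<open>e\<close>, then carried
      through every context.\<close>
    then have "near A (SUP T \<in> {T. compatible A T}. g T) \<lbrakk>t\<rbrakk> \<lbrakk>s\<rbrakk>"
      using g_le by (intro near_of_traces) (auto simp: g_def Pr_def)
    then show "(SUP C \<in> Cs. f C) \<le> (SUP T \<in> {T. compatible A T}. g T)"
      using Cs[OF T0] by (intro cSUP_least) (auto simp: f_def Cs_def intro: ctx_diff_le[OF assms])
  qed
  then show ?thesis
    by (simp add: trace_dist_def ctx_dist_def f_def g_def Cs_def)
qed

end
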